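(* Let $n\ge 1$, let $D_0\subset\mathbb{C}^n$ (or $D_0\subset\mathbb{R}^n\subset\mathbb{C}^n$), let $\delta>0$, and let $f:D_\delta\to\mathbb{C}^n$ be analytic, where $D_\delta$ is the complex $\delta$-neighbourhood of $D_0$. Put $\varepsilon=\|f-\xi\|_{D_\delta}$, where $\xi$ is the identity map, and suppose that $\varepsilon>0$ and $$\frac{\varepsilon}{\delta}\le\frac{1}{6\mathrm{e}}.$$ Let $M_\varepsilon=\dfrac{\delta}{6\mathrm{e}\,\varepsilon}$. Then for every integer $m$ with $2\le m\le M_\varepsilon+1$, the interpolating vector field of order $m$, $$X_m(x)=\sum_{k=1}^m\frac{(-1)^{k-1}}{k}\Delta_k(x),$$ is analytic in $D_{\delta/3}$, satisfies $\|X_m\|_{D_{\delta/3}}\le 2\varepsilon$, and $$\|\Phi^1_{X_m}-f\|_{D_0}\le 3\varepsilon\left(\frac{6(m-1)\varepsilon}{\delta}\right)^{m}.$$ Moreover, for $m=\lfloor M_\varepsilon\rfloor+1$, $$\|\Phi^1_{X_m}-f\|_{D_0}\le 3\,\varepsilon\exp\left(-\frac{\delta}{6\mathrm{e}\,\varepsilon}\right).$$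
   Context: Norms: for vectors in $\mathbb{C}^n$ we use the infinity norm $|x|=\max_i|x_i|$; for a function $g$ on a set $D$ with values in $\mathbb{C}^n$, $\|g\|_D=\sup_{x\in D}|g(x)|$. Neighbourhoods: for $r>0$, $D_r=\{z\in\mathbb{C}^n:\ |z-x|<r\text{ for some }x\in D_0\}$ denotes the complex $r$-neighbourhood of $D_0$. The map $\xi$ is the identity map, $\xi(x)=x$. "Analytic" on $D_r$ means complex analytic (holomorphic). Finite differences: the functions $\Delta_k$ are defined recursively from $f$ by $$\Delta_0(x)=x,\qquad \Delta_k(x)=\Delta_{k-1}(f(x))-\Delta_{k-1}(x)\quad\text{for }k\ge 1,$$ equivalently $\Delta_k(x)=\sum_{i=0}^k\binom{k}{i}(-1)^{k-i}f^i(x)$, where $f^i$ is the $i$-th iterate of $f$. The statement that $X_m$ is analytic in $D_{\delta/3}$ includes that the iterates $f^i(x)$, $0\le i\le m$, are defined for all $x\in D_{\delta/3}$. Flow: $\Phi^t_X$ denotes the flow defined by the autonomous differential equation $\dot x=X(x)$ ($t$ real), so $\Phi^1_X$ is its time-one map. For $X=X_m$, considered as a vector field on $D_{\delta/3}$, the estimates of $\|\Phi^1_{X_m}-f\|_{D_0}$ include that the solution with any initial condition in $D_0$ exists in $D_{\delta/3}$ for $0\le t\le 1$. *)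

theory Defs
  imports "HOL-Analysis.Analysis"
begin

text \<open>The norm on \<^typ>\<open>complex ^ 'n\<close> below is the maximum of the moduli of the components. It
  differs from \<^const>\<open>infnorm\<close>, which maximises over real and imaginary parts separately.\<close>

definition max_norm :: "complex ^ 'n \<Rightarrow> real" where
  "max_norm x = Max (range (\<lambda>i. cmod (x $ i)))"

text \<open>The supremum is taken in \<^typ>\<open>ennreal\<close>, so that it is meaningful for unbounded functions
  (value \<open>\<infinity>\<close>) and on the empty set (value \<open>0\<close>).\<close>

definition sup_norm_on :: "(complex ^ 'n) set \<Rightarrow> (complex ^ 'n \<Rightarrow> complex ^ 'n) \<Rightarrow> ennreal" where
  "sup_norm_on D g = (SUP x\<in>D. ennreal (max_norm (g x)))"

definition complex_nbhd :: "(complex ^ 'n) set \<Rightarrow> real \<Rightarrow> (complex ^ 'n) set" where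
  "complex_nbhd D r = {z. \<exists>x\<in>D. max_norm (z - x) < r}"

text \<open>Holomorphy in several variables, meant for open sets: at every point there is a Frechet
  derivative which is complex linear (\<^const>\<open>has_derivative\<close> alone asks only for real linearity).\<close>

definition holomorphic_map_on ::
    "(complex ^ 'n \<Rightarrow> complex ^ 'm) \<Rightarrow> (complex ^ 'n) set \<Rightarrow> bool" where
  "holomorphic_map_on f U \<longleftrightarrow>
    (\<forall>z\<in>U. \<exists>A. (f has_derivative A) (at z) \<and> (\<forall>c v. A (c *s v) = c *s A v))"

primrec fin_diff :: "(complex ^ 'n \<Rightarrow> complex ^ 'n) \<Rightarrow> nat \<Rightarrow> complex ^ 'n \<Rightarrow> complex ^ 'n" where
  "fin_diff f 0 x = x"
| "fin_diff f (Suc k) x = fin_diff f k (f x) - fin_diff f k x"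

definition interp_field ::
    "(complex ^ 'n \<Rightarrow> complex ^ 'n) \<Rightarrow> nat \<Rightarrow> complex ^ 'n \<Rightarrow> complex ^ 'n" where
  "interp_field f m x = (\<Sum>k=1..m. ((-1) ^ (k - 1) / real k) *\<^sub>R fin_diff f k x)"

text \<open>All functions are total, so the domain \<open>D\<close> of a partial map \<open>f\<close> is tracked explicitly:
  the iterate of order \<open>i\<close> is defined at \<open>x\<close> if \<open>f\<close> is only ever applied to points of \<open>D\<close>.\<close>

definition iterate_defined_at ::
    "(complex ^ 'n \<Rightarrow> complex ^ 'n) \<Rightarrow> (complex ^ 'n) set \<Rightarrow> nat \<Rightarrow> complex ^ 'n \<Rightarrow> bool" where
  "iterate_defined_at f D i x \<longleftrightarrow> (\<forall>j<i. (f ^^ j) x \<in> D)"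

text \<open>\<open>\<phi>\<close> solves the autonomous equation \<open>\<phi>' = X \<phi>\<close>, with \<open>\<phi> 0 = x\<close>, between the times
  \<open>0\<close> and \<open>t\<close> (of either sign), and remains in the domain \<open>U\<close> of the vector field.\<close>

definition solves_ivp ::
    "(complex ^ 'n) set \<Rightarrow> (complex ^ 'n \<Rightarrow> complex ^ 'n) \<Rightarrow> complex ^ 'n \<Rightarrow> real
      \<Rightarrow> (real \<Rightarrow> complex ^ 'n) \<Rightarrow> bool" where
  "solves_ivp U X x t \<phi> \<longleftrightarrow> \<phi> 0 = x \<and>
    (\<forall>s \<in> closed_segment 0 t. \<phi> s \<in> U \<and>
      (\<phi> has_vector_derivative X (\<phi> s)) (at s within closed_segment 0 t))"

definition flow_defined_at ::
    "(complex ^ 'n) set \<Rightarrow> (complex ^ 'n \<Rightarrow> complex ^ 'n) \<Rightarrow> real \<Rightarrow> complex ^ 'n \<Rightarrow> bool" where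
  "flow_defined_at U X t x \<longleftrightarrow> (\<exists>!y. \<exists>\<phi>. solves_ivp U X x t \<phi> \<and> \<phi> t = y)"

text \<open>Only meaningful where \<^const>\<open>flow_defined_at\<close> holds.\<close>

definition flow ::
    "(complex ^ 'n) set \<Rightarrow> (complex ^ 'n \<Rightarrow> complex ^ 'n) \<Rightarrow> real \<Rightarrow> complex ^ 'n \<Rightarrow> complex ^ 'n" where
  "flow U X t x = (THE y. \<exists>\<phi>. solves_ivp U X x t \<phi> \<and> \<phi> t = y)"

end

theory Submission
  imports Defs "HOL-Complex_Analysis.Conformal_Mappings"
begin

text \<open>
  The map is embedded in the family \<open>F \<mu> = \<xi> + \<mu> g\<close> with complex parameter, where
  \<open>g = (f - \<xi>) / \<epsilon>\<close> has norm at most 1, so that \<open>F \<epsilon> = f\<close>. Let \<open>X \<mu>\<close> be the interpolating field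
  of \<open>F \<mu>\<close>, and let \<open>e(\<mu>)\<close> be the difference, at a fixed point of \<open>D0\<close>, between the time-one map of
  \<open>X \<mu>\<close> and \<open>F \<mu>\<close>. Three facts hold with \<open>\<mu>max = \<delta> / (6 (m - 1))\<close>.

  \<^item> On the disc \<open>|\<mu>| < \<mu>max\<close> the field is bounded by \<open>2 |\<mu>|\<close> on \<open>D_(\<delta>/3)\<close>, so its flow stays there up
    to time one, and \<open>|e(\<mu>)| \<le> 2 |\<mu>| + |\<mu>| \<le> 3 \<mu>max\<close>. A finite difference is an increment of the
    preceding one over a step of size \<open>|\<mu>|\<close>, and the Schwarz lemma on a complex line turns this into a
    factor \<open>2 |\<mu>| / \<rho>\<close> at the price of shrinking the domain by \<open>\<rho>\<close> (\<open>fin_diff_bound\<close>, \<open>X_bound\<close>).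
  \<^item> The function \<open>e\<close> is holomorphic on this disc: the flow is a locally uniform limit of Euler polygons,
    and these are compositions of holomorphic maps (\<open>time_one_holomorphic\<close>).
  \<^item> It vanishes at 0 to order \<open>m + 1\<close>. The Newton interpolation polynomial in time through the
    first \<open>m + 1\<close> points of an orbit of \<open>F \<mu>\<close> solves the equation of \<open>X \<mu>\<close> up to \<open>O(|\<mu>| ^ (m + 1))\<close>
    and passes through \<open>F \<mu> x\<close> at time one, so Gronwall's inequality applies
    (\<open>time_one_order_of_contact\<close>).

  The Schwarz lemma for zeros of order \<open>m + 1\<close> gives
  \<open>|e(\<epsilon>)| \<le> 3 \<mu>max (\<epsilon> / \<mu>max) ^ (m + 1) = 3 \<epsilon> (6 (m - 1) \<epsilon> / \<delta>) ^ m\<close>. For \<open>m - 1 = \<lfloor>M\<rfloor>\<close> the base is at most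
  \<open>exp (- 1)\<close> and the exponent at least \<open>M\<close>, which is the exponential estimate.
\<close>

section \<open>The maximum norm\<close>

lemma max_norm_le_iff: "max_norm x \<le> b \<longleftrightarrow> (\<forall>i. cmod (x $ i) \<le> b)"
  unfolding max_norm_def by (subst Max_le_iff) auto

lemma max_norm_less_iff: "max_norm x < b \<longleftrightarrow> (\<forall>i. cmod (x $ i) < b)"
  unfolding max_norm_def by (subst Max_less_iff) auto

lemma cmod_component_le_max_norm: "cmod (x $ i) \<le> max_norm x"
  using max_norm_le_iff[of x "max_norm x"] by simp

lemma max_norm_nonneg: "0 \<le> max_norm x"
  using cmod_component_le_max_norm[of x] norm_ge_zero order_trans by blast

lemma max_norm_zero [simp]: "max_norm 0 = 0"
  by (rule antisym) (auto simp: max_norm_le_iff max_norm_nonneg)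

lemma max_norm_eq_0D: "max_norm x \<le> 0 \<Longrightarrow> x = 0"
  by (auto simp: max_norm_le_iff vec_eq_iff)

lemma max_norm_triangle: "max_norm (x + y) \<le> max_norm x + max_norm y"
  by (auto simp: max_norm_le_iff intro!: norm_triangle_le add_mono cmod_component_le_max_norm)

lemma max_norm_minus: "max_norm (- x) = max_norm x"
  by (simp add: max_norm_def)

lemma max_norm_diff_commute: "max_norm (x - y) = max_norm (y - x)"
  by (metis max_norm_minus minus_diff_eq)

lemma max_norm_diff_triangle: "max_norm (x - y) \<le> max_norm x + max_norm y"
  using max_norm_triangle[of x "- y"] by (simp add: max_norm_minus)

lemma max_norm_smult: "max_norm (c *s x) = cmod c * max_norm x"
proof (rule antisym)
  show "max_norm (c *s x) \<le> cmod c * max_norm x"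
    by (auto simp: max_norm_le_iff norm_mult intro!: mult_left_mono cmod_component_le_max_norm)
  show "cmod c * max_norm x \<le> max_norm (c *s x)"
  proof (cases "c = 0")
    case False
    have "max_norm x \<le> max_norm (c *s x) / cmod c"
      using False cmod_component_le_max_norm[of "c *s x"]
      by (auto simp: max_norm_le_iff norm_mult field_simps)
    with False show ?thesis by (simp add: field_simps)
  qed (simp add: max_norm_nonneg)
qed

lemma scaleR_eq_smult: "r *\<^sub>R (x :: complex ^ 'n) = complex_of_real r *s x"
  by (simp add: vec_eq_iff vector_scaleR_component scaleR_conv_of_real[where 'a=complex])

lemma max_norm_scaleR: "max_norm (r *\<^sub>R x) = \<bar>r\<bar> * max_norm x"
  by (simp add: scaleR_eq_smult max_norm_smult)

lemma max_norm_sum: "max_norm (\<Sum>i\<in>A. h i) \<le> (\<Sum>i\<in>A. max_norm (h i))"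
proof (induction A rule: infinite_finite_induct)
  case (insert a A)
  then show ?case using max_norm_triangle[of "h a" "sum h A"] by simp
qed auto

lemma max_norm_le_norm: "max_norm x \<le> norm x"
  by (simp add: max_norm_le_iff Finite_Cartesian_Product.norm_nth_le)

text \<open>The comparison of norms lets constants that affect only the speed of convergence or the implied
  constant of an \<open>O\<close>-estimate be computed in the Euclidean norm.\<close>

lemma norm_le_card_max_norm: "norm (x :: complex ^ 'n) \<le> real CARD('n) * max_norm x"
proof -
  have "norm x \<le> (\<Sum>i\<in>UNIV. cmod (x $ i))"
    unfolding norm_vec_def by (rule L2_set_le_sum) auto
  also have "\<dots> \<le> (\<Sum>i\<in>(UNIV :: 'n set). max_norm x)"
    by (intro sum_mono cmod_component_le_max_norm)
  finally show ?thesis by simp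
qed

lemma continuous_on_max_norm: "continuous_on A max_norm"
proof (rule continuous_on_subset[OF _ subset_UNIV], clarsimp simp: continuous_on_iff)
  fix x :: "complex ^ 'a" and e :: real
  assume e: "e > 0"
  have *: "\<bar>max_norm y - max_norm x\<bar> \<le> norm (y - x)" for y
    using max_norm_triangle[of "y - x" x] max_norm_triangle[of "x - y" y]
      max_norm_le_norm[of "y - x"] max_norm_diff_commute[of x y] by simp
  then show "\<exists>d>0. \<forall>y. dist y x < d \<longrightarrow> dist (max_norm y) (max_norm x) < e"
    using e le_less_trans[OF *] by (intro exI[of _ e]) (auto simp: dist_norm)
qed

lemma closed_max_norm_ball: "closed {y. max_norm (y - x) \<le> r}"
proof -
  have "continuous_on UNIV (\<lambda>y. max_norm (y - x))"
    by (rule continuous_on_compose2[OF continuous_on_max_norm[of UNIV]]) (auto intro: continuous_intros)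
  then show ?thesis by (intro closed_Collect_le continuous_on_const)
qed

text \<open>Applying the mean value inequality to each component avoids the dimensional factor that the
  Euclidean norm would introduce; the sharp bound keeps orbits inside the prescribed domains.\<close>

lemma max_norm_mean_value:
  fixes \<phi> :: "real \<Rightarrow> complex ^ 'n"
  assumes d: "\<And>s. s \<in> {0..t} \<Longrightarrow> (\<phi> has_vector_derivative v s) (at s within {0..t})"
    and b: "\<And>s. s \<in> {0..t} \<Longrightarrow> max_norm (v s) \<le> B" and t: "0 \<le> t"
  shows "max_norm (\<phi> t - \<phi> 0) \<le> B * t"
  unfolding max_norm_le_iff
proof
  fix i
  have "norm (\<phi> t $ i - \<phi> 0 $ i) \<le> B * norm (t - 0)"
  proof (rule differentiable_bound[where S = "{0..t}" and f' = "\<lambda>s h. h *\<^sub>R (v s $ i)"])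
    fix s assume s: "s \<in> {0..t}"
    show "((\<lambda>s. \<phi> s $ i) has_derivative (\<lambda>h. h *\<^sub>R (v s $ i))) (at s within {0..t})"
      using bounded_linear.has_vector_derivative[OF bounded_linear_vec_nth d[OF s], of i]
      by (simp add: has_vector_derivative_def)
    show "onorm (\<lambda>h. h *\<^sub>R (v s $ i)) \<le> B"
      using b[OF s] by (intro onorm_le) (auto simp: max_norm_le_iff mult.commute[of B] intro!: mult_left_mono)
  qed (use t in auto)
  then show "cmod ((\<phi> t - \<phi> 0) $ i) \<le> B * t" using t by simp
qed

section \<open>Schwarz lemmas for functions with many zeros\<close>

text \<open>On the circle \<open>|z| = r\<close> the factor \<open>|z - a|\<close> is at least \<open>r - |a|\<close>. The maximum principle carries
  the resulting bound for the quotient inside, and then \<open>r\<close> tends to \<open>R\<close>.\<close>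

lemma divide_out_zero:
  assumes q: "q holomorphic_on ball 0 R" and B: "\<And>z. z \<in> ball 0 R \<Longrightarrow> cmod (q z) \<le> B"
    and a: "cmod a < R" "q a = 0"
  obtains p where "p holomorphic_on ball 0 R" "\<And>z. q z = (z - a) * p z"
    "\<And>z. z \<in> ball 0 R \<Longrightarrow> cmod (p z) \<le> B / (R - cmod a)"
proof -
  define p where "p z = (if z = a then deriv q a else (q z - q a) / (z - a))" for z
  have p: "p holomorphic_on ball 0 R"
    unfolding p_def using a by (intro pole_lemma[OF q]) (auto simp: interior_open)
  have eq: "q z = (z - a) * p z" for z using a by (simp add: p_def)
  have "cmod (p z) \<le> B / (R - cmod a)" if z: "z \<in> ball 0 R" for z
  proof -
    have B0: "0 \<le> B" using B[of 0] a norm_ge_zero[of a] by (force intro: order_trans[OF norm_ge_zero])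
    define m0 where "m0 = max (cmod a) (cmod z)"
    have m0: "m0 < R" "0 \<le> m0" "cmod a \<le> m0" "cmod z \<le> m0" using a z by (auto simp: m0_def max_def)
    have main: "cmod (p z) * (r - cmod a) \<le> B" if r: "m0 < r" "r < R" for r
    proof -
      have "cmod (p z) \<le> B / (r - cmod a)"
      proof (rule maximum_modulus_frontier[where S = "cball 0 r" and f = p])
        have sub: "cball 0 r \<subseteq> ball 0 R" using r by auto
        show "p holomorphic_on interior (cball 0 r)"
          using p sub by (meson holomorphic_on_subset interior_subset subset_trans)
        show "continuous_on (closure (cball 0 r)) p"
          using p sub by (auto intro: holomorphic_on_imp_continuous_on holomorphic_on_subset)
        show "z \<in> cball 0 r" using m0 r by auto
        show "cmod (p w) \<le> B / (r - cmod a)" if w: "w \<in> frontier (cball 0 r)" for w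
        proof -
          have w: "cmod w = r" using w m0 r by (simp add: frontier_def)
          have "r - cmod a \<le> cmod (w - a)" using norm_triangle_ineq2[of w a] w by simp
          moreover have "r - cmod a > 0" using m0 r by linarith
          moreover have "cmod (w - a) * cmod (p w) \<le> B"
            using B[of w] w r eq[of w] by (simp add: norm_mult)
          ultimately have "(r - cmod a) * cmod (p w) \<le> B"
            by (meson mult_right_mono norm_ge_zero order_trans)
          then show ?thesis using \<open>r - cmod a > 0\<close> by (simp add: field_simps)
        qed
      qed auto
      then show ?thesis using m0 r by (simp add: field_simps)
    qed
    have "cmod (p z) * (R - cmod a) \<le> B"
    proof (rule tendsto_le[where F = "at_left R"])
      show "((\<lambda>r. cmod (p z) * (r - cmod a)) \<longlongrightarrow> cmod (p z) * (R - cmod a)) (at_left R)"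
        by (intro tendsto_intros)
      show "\<forall>\<^sub>F r in at_left R. cmod (p z) * (r - cmod a) \<le> B"
        using eventually_at_left_real[OF m0(1)] by eventually_elim (use main in auto)
    qed auto
    then show ?thesis using a by (simp add: field_simps)
  qed
  then show ?thesis using that p eq by blast
qed

text \<open>The zeros are divided out one after the other.\<close>

lemma schwarz_lemma_nodes:
  assumes "q holomorphic_on ball 0 R" and "\<And>z. z \<in> ball 0 R \<Longrightarrow> cmod (q z) \<le> B"
    and "finite A" "\<And>a. a \<in> A \<Longrightarrow> cmod a < R" "\<And>a. a \<in> A \<Longrightarrow> q a = 0"
    and "z \<in> ball 0 R"
  shows "cmod (q z) \<le> B * (\<Prod>a\<in>A. cmod (z - a) / (R - cmod a))"
  using assms(3,1,2,4,5,6)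
proof (induction A arbitrary: q B rule: finite_induct)
  case empty
  then show ?case by simp
next
  case (insert a A)
  obtain p where p: "p holomorphic_on ball 0 R" "\<And>z. q z = (z - a) * p z"
    "\<And>z. z \<in> ball 0 R \<Longrightarrow> cmod (p z) \<le> B / (R - cmod a)"
    using divide_out_zero[of q R B a] insert.prems by auto
  have "cmod (p z) \<le> B / (R - cmod a) * (\<Prod>a\<in>A. cmod (z - a) / (R - cmod a))"
  proof (rule insert.IH)
    show "p b = 0" if "b \<in> A" for b
      using insert.prems(4)[of b] insert.hyps that p(2)[of b] by auto
  qed (use p insert.prems in auto)
  then have "cmod (z - a) * cmod (p z) \<le> cmod (z - a) * (B / (R - cmod a) * (\<Prod>a\<in>A. cmod (z - a) / (R - cmod a)))"
    by (intro mult_left_mono) auto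
  then show ?case using insert.hyps by (simp add: p(2)[of z] norm_mult mult_ac)
qed

text \<open>A multiple zero at the origin is expressed by a growth bound near 0, the form in which the order
  of contact is obtained. Each division by \<open>z\<close> lowers the exponent by one.\<close>

lemma schwarz_lemma_order:
  assumes "q holomorphic_on ball 0 R" and "\<And>z. z \<in> ball 0 R \<Longrightarrow> cmod (q z) \<le> B"
    and "0 < s" "\<And>z. z \<noteq> 0 \<Longrightarrow> cmod z < s \<Longrightarrow> cmod (q z) \<le> C * cmod z ^ k"
    and "z \<in> ball 0 R"
  shows "cmod (q z) \<le> B * (cmod z / R) ^ k"
  using assms(1,2,4,5)
proof (induction k arbitrary: q B)
  case 0
  then show ?case by simp
next
  case (Suc k)
  have R: "R > 0" using Suc.prems(4) by (auto intro: le_less_trans[OF norm_ge_zero])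
  \<comment> \<open>The growth bound is assumed off the origin only; continuity extends it to 0, and since the
    exponent is positive it forces a zero there.\<close>
  have "isCont q 0"
    using Suc.prems(1) R by (meson centre_in_ball continuous_on_eq_continuous_at holomorphic_on_imp_continuous_on open_ball)
  then have "((\<lambda>z. cmod (q z)) \<longlongrightarrow> cmod (q 0)) (at 0)"
    by (intro tendsto_norm) (simp add: isCont_def)
  then have "cmod (q 0) \<le> C * cmod 0 ^ Suc k"
  proof (rule tendsto_le[rotated 2])
    show "((\<lambda>z. C * cmod z ^ Suc k) \<longlongrightarrow> C * cmod 0 ^ Suc k) (at 0)"
      by (intro tendsto_intros)
    show "\<forall>\<^sub>F z in at 0. cmod (q z) \<le> C * cmod z ^ Suc k"
      unfolding eventually_at using \<open>0 < s\<close> Suc.prems(3) by auto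
  qed auto
  then have q0: "q 0 = 0" by simp
  obtain p where p: "p holomorphic_on ball 0 R" "\<And>z. q z = (z - 0) * p z"
    "\<And>z. z \<in> ball 0 R \<Longrightarrow> cmod (p z) \<le> B / (R - cmod 0)"
    using divide_out_zero[of q R B 0] Suc.prems R q0 by auto
  have "cmod (p z) \<le> (B / R) * (cmod z / R) ^ k"
  proof (rule Suc.IH)
    show "cmod (p z) \<le> C * cmod z ^ k" if "z \<noteq> 0" "cmod z < s" for z
      using Suc.prems(3)[OF that] that p(2)[of z] by (simp add: norm_mult algebra_simps)
  qed (use p Suc.prems in auto)
  then have "cmod z * cmod (p z) \<le> cmod z * ((B / R) * (cmod z / R) ^ k)"
    by (intro mult_left_mono) auto
  then show ?case by (simp add: p(2)[of z] norm_mult mult_ac)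
qed

section \<open>Ordinary differential equations\<close>

text \<open>Picard iteration on the whole unit interval. In the norm with weight \<open>exp (- 2 L t)\<close> the
  integral operator contracts by the factor \<open>1 / 2\<close> whatever the size of \<open>L\<close>. The vector
  field is Lipschitz only on \<open>K\<close>, hence the hypothesis that the operator preserves paths in \<open>K\<close>.\<close>

lemma picard_lindelof:
  fixes V :: "'a::banach \<Rightarrow> 'a"
  assumes K: "closed K" "x \<in> K" and L: "L > 0"
    and lip: "\<And>y z. y \<in> K \<Longrightarrow> z \<in> K \<Longrightarrow> norm (V y - V z) \<le> L * norm (y - z)"
    and inv: "\<And>\<psi> t. continuous_on {0..1::real} \<psi> \<Longrightarrow> \<psi> ` {0..1} \<subseteq> K \<Longrightarrow> t \<in> {0..1} \<Longrightarrow>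
        x + integral {0..t} (\<lambda>s. V (\<psi> s)) \<in> K"
  obtains \<phi> where "\<phi> 0 = x" "\<And>t. t \<in> {0..1::real} \<Longrightarrow> \<phi> t \<in> K"
    "\<And>t. t \<in> {0..1} \<Longrightarrow> (\<phi> has_vector_derivative V (\<phi> t)) (at t within {0..1})"
proof -
  define T where "T \<psi> = (\<lambda>t. x + integral {0..t} (\<lambda>s. V (\<psi> s)))" for \<psi> :: "real \<Rightarrow> 'a"
  have "continuous_on K V"
    unfolding continuous_on_iff dist_norm
  proof (intro ballI allI impI)
    fix y e assume "y \<in> K" "(0::real) < e"
    then have "\<forall>z\<in>K. norm (z - y) < e / L \<longrightarrow> norm (V z - V y) < e"
      using lip L by (auto simp: field_simps intro: le_less_trans)
    then show "\<exists>d>0. \<forall>z\<in>K. norm (z - y) < d \<longrightarrow> norm (V z - V y) < e"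
      using \<open>0 < e\<close> L by (intro exI[of _ "e / L"]) auto
  qed
  then have Vc: "continuous_on {0..1} (\<lambda>s. V (\<psi> s))"
    if "continuous_on {0..1} \<psi>" "\<psi> ` {0..1} \<subseteq> K" for \<psi> :: "real \<Rightarrow> 'a"
    using that by (auto intro: continuous_on_compose2)
  have Td: "(T \<psi> has_vector_derivative V (\<psi> t)) (at t within {0..1})"
    if "continuous_on {0..1} \<psi>" "\<psi> ` {0..1} \<subseteq> K" "t \<in> {0..1}" for \<psi> t
    unfolding T_def has_vector_derivative_add_const
    using has_vector_derivative_add[OF has_vector_derivative_const
        integral_has_vector_derivative[OF Vc[OF that(1,2)] that(3)], of x] by simp
  have Tc: "continuous_on {0..1} (T \<psi>)" if "continuous_on {0..1} \<psi>" "\<psi> ` {0..1} \<subseteq> K" for \<psi>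
    using Td[OF that] by (meson has_vector_derivative_continuous continuous_on_eq_continuous_within)
  have Tin: "T \<psi> ` {0..1} \<subseteq> K" if "continuous_on {0..1} \<psi>" "\<psi> ` {0..1} \<subseteq> K" for \<psi>
    using inv[OF that] by (auto simp: T_def)
  define P where "P n = (T ^^ n) (\<lambda>_. x)" for n
  have PS: "P (Suc n) = T (P n)" and P0: "P 0 = (\<lambda>_. x)" for n by (simp_all add: P_def)
  have P: "continuous_on {0..1} (P n) \<and> P n ` {0..1} \<subseteq> K" for n
  proof (induction n)
    case (Suc n)
    then show ?case using Tc Tin by (simp add: PS)
  qed (use K in \<open>auto simp: P_def\<close>)
  have PK: "P n t \<in> K" if "t \<in> {0..1}" for n t
    using P[of n] that by blast
  have Tdiff: "norm (T \<psi> t - T \<omega> t) \<le> C / 2 * exp (2 * L * t)"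
    if \<psi>: "continuous_on {0..1} \<psi>" "\<psi> ` {0..1} \<subseteq> K" and \<omega>: "continuous_on {0..1} \<omega>" "\<omega> ` {0..1} \<subseteq> K"
      and d: "\<And>s. s \<in> {0..1} \<Longrightarrow> norm (\<psi> s - \<omega> s) \<le> C * exp (2 * L * s)"
      and t: "t \<in> {0..1}" and C: "C \<ge> 0" for \<psi> \<omega> t C
  proof -
    have sub: "{0..t} \<subseteq> {0..1}" using t by auto
    have int: "(\<lambda>s. V (\<psi> s)) integrable_on {0..t}" "(\<lambda>s. V (\<omega> s)) integrable_on {0..t}"
      using Vc[OF \<psi>] Vc[OF \<omega>] sub by (auto intro!: integrable_continuous_real intro: continuous_on_subset)
    have ig: "((\<lambda>s. L * (C * exp (2 * L * s))) has_integral (C / 2 * exp (2 * L * t) - C / 2 * exp (2 * L * 0))) {0..t}"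
    proof (rule fundamental_theorem_of_calculus)
      show "((\<lambda>s. C / 2 * exp (2 * L * s)) has_vector_derivative L * (C * exp (2 * L * s))) (at s within {0..t})" for s
        unfolding has_real_derivative_iff_has_vector_derivative[symmetric]
        by (auto intro!: derivative_eq_intros)
    qed (use t in auto)
    have "T \<psi> t - T \<omega> t = integral {0..t} (\<lambda>s. V (\<psi> s) - V (\<omega> s))"
      using int by (simp add: T_def integral_diff)
    also have "norm \<dots> \<le> integral {0..t} (\<lambda>s. L * (C * exp (2 * L * s)))"
    proof (rule integral_norm_bound_integral)
      fix s assume s: "s \<in> {0..t}"
      then have s1: "s \<in> {0..1}" using sub by auto
      have "norm (V (\<psi> s) - V (\<omega> s)) \<le> L * norm (\<psi> s - \<omega> s)"
        using \<psi>(2) \<omega>(2) s1 by (intro lip) auto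
      also have "\<dots> \<le> L * (C * exp (2 * L * s))" using d[OF s1] L by simp
      finally show "norm (V (\<psi> s) - V (\<omega> s)) \<le> L * (C * exp (2 * L * s))" .
    qed (use int ig in \<open>auto intro: integrable_diff has_integral_integrable\<close>)
    also have "\<dots> \<le> C / 2 * exp (2 * L * t)"
      using C by (subst integral_unique[OF ig]) simp
    finally show ?thesis .
  qed
  have "compact ((\<lambda>t. P 1 t - P 0 t) ` {0..1})"
    using P by (intro compact_continuous_image continuous_intros) auto
  then obtain C where C: "C > 0" "\<And>t. t \<in> {0..1} \<Longrightarrow> norm (P 1 t - P 0 t) \<le> C"
    by (auto dest!: compact_imp_bounded simp: bounded_pos)
  have step: "norm (P (Suc n) t - P n t) \<le> C * (1 / 2) ^ n * exp (2 * L * t)" if "t \<in> {0..1}" for n t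
    using that
  proof (induction n arbitrary: t)
    case 0
    have "C * 1 \<le> C * exp (2 * L * t)" using 0 C L by (intro mult_left_mono) auto
    then show ?case using C(2)[of t] 0 by simp
  next
    case (Suc n)
    have "norm (P (Suc (Suc n)) t - P (Suc n) t) \<le> C * (1 / 2) ^ n / 2 * exp (2 * L * t)"
      unfolding PS[of "Suc n"] PS[of n]
      using P[of n] P[of "Suc n"] Suc C by (intro Tdiff) (auto simp: PS)
    then show ?case by simp
  qed
  have "uniform_limit {0..1} (\<lambda>n t. \<Sum>i<n. (P (Suc i) t - P i t)) (\<lambda>t. \<Sum>i. (P (Suc i) t - P i t)) sequentially"
  proof (rule Weierstrass_m_test)
    fix n t assume t: "t \<in> {0..1::real}"
    have "C * (1 / 2) ^ n * exp (2 * L * t) \<le> C * (1 / 2) ^ n * exp (2 * L)"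
      using t L C by (intro mult_left_mono) auto
    with step[OF t, of n] show "norm (P (Suc n) t - P n t) \<le> C * (1 / 2) ^ n * exp (2 * L)"
      by linarith
  qed (intro summable_mult summable_mult2 summable_geometric, simp)
  then have ul: "uniform_limit {0..1} (\<lambda>n t. P n t - x) (\<lambda>t. \<Sum>i. (P (Suc i) t - P i t)) sequentially"
    by (simp add: sum_lessThan_telescope[of "\<lambda>n. P n _"] P0)
  define \<phi> where "\<phi> t = x + (\<Sum>i. (P (Suc i) t - P i t))" for t
  have ul: "uniform_limit {0..1} P \<phi> sequentially"
    using uniform_limit_add[OF uniform_limit_const[where c = "\<lambda>_. x"] ul] by (simp add: \<phi>_def[abs_def])
  have \<phi>c: "continuous_on {0..1} \<phi>"
    using P by (intro uniform_limit_theorem[OF _ ul]) auto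
  have \<phi>K: "\<phi> ` {0..1} \<subseteq> K"
  proof clarify
    fix t :: real assume t: "t \<in> {0..1}"
    show "\<phi> t \<in> K"
      using PK[OF t] t by (intro closed_sequentially[OF K(1) _ tendsto_uniform_limitI[OF ul t]]) auto
  qed
  have fixpt: "\<phi> t = T \<phi> t" if t: "t \<in> {0..1}" for t
  proof -
    have "norm (\<phi> t - T \<phi> t) \<le> e" if e: "e > 0" for e
    proof -
      define e' where "e' = e / (1 + exp (2 * L))"
      have e': "e' > 0" using e by (auto simp: e'_def intro!: divide_pos_pos add_pos_pos)
      from uniform_limitD[OF ul e'] obtain n where
        n: "\<And>k t. k \<ge> n \<Longrightarrow> t \<in> {0..1} \<Longrightarrow> norm (P k t - \<phi> t) < e'"
        unfolding eventually_sequentially dist_norm by blast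
      have "norm (T (P n) t - T \<phi> t) \<le> 2 * e' / 2 * exp (2 * L * t)"
      proof (rule Tdiff)
        fix s :: real assume s: "s \<in> {0..1}"
        have "e' * 1 \<le> 2 * e' * exp (2 * L * s)" using e' s L by (intro mult_mono) auto
        then show "norm (P n s - \<phi> s) \<le> 2 * e' * exp (2 * L * s)"
          using n[OF order_refl s] by linarith
      qed (use P \<phi>c \<phi>K t e' in auto)
      also have "\<dots> \<le> e' * exp (2 * L)" using t L e' by simp
      finally have "norm (P (Suc n) t - T \<phi> t) \<le> e' * exp (2 * L)" by (simp add: PS)
      moreover have "norm (\<phi> t - P (Suc n) t) \<le> e'"
        using n[of "Suc n" t] t by (simp add: norm_minus_commute less_imp_le)
      ultimately have "norm (\<phi> t - T \<phi> t) \<le> e' + e' * exp (2 * L)"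
        by (rule norm_diff_triangle_le[rotated])
      also have "\<dots> = e' * (1 + exp (2 * L))" by (simp add: algebra_simps)
      also have "\<dots> = e"
        using add_pos_pos[OF zero_less_one exp_gt_zero[of "2 * L"]] by (simp add: e'_def)
      finally show ?thesis .
    qed
    then show ?thesis using field_le_epsilon[of "norm (\<phi> t - T \<phi> t)" 0] by simp
  qed
  show ?thesis
  proof (rule that)
    show "\<phi> 0 = x" by (subst fixpt) (auto simp: T_def)
    show "\<phi> t \<in> K" if "t \<in> {0..1}" for t using \<phi>K that by auto
    show "(\<phi> has_vector_derivative V (\<phi> t)) (at t within {0..1})" if "t \<in> {0..1}" for t
      using has_vector_derivative_transform[OF that _ Td[OF \<phi>c \<phi>K that]] fixpt by auto
  qed
qed

text \<open>The function \<open>exp (- (2 L + 1) t) |w t|\<^sup>2 - \<eta>\<^sup>2 t\<close> is nonincreasing. The additional 1 in the rate comes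
  from \<open>2 |w| \<eta> \<le> |w|\<^sup>2 + \<eta>\<^sup>2\<close> and becomes the summand \<open>1 / 2\<close> of the exponent.\<close>

lemma gronwall:
  fixes w :: "real \<Rightarrow> 'a::real_inner"
  assumes d: "\<And>t. t \<in> {0..1} \<Longrightarrow> (w has_vector_derivative w' t) (at t within {0..1})"
    and b: "\<And>t. t \<in> {0..1} \<Longrightarrow> norm (w' t) \<le> L * norm (w t) + \<eta>"
    and w0: "w 0 = 0" and nn: "0 \<le> \<eta>" "0 \<le> L"
  shows "norm (w 1) \<le> \<eta> * exp (L + 1 / 2)"
proof -
  define c where "c = 2 * L + 1"
  define u where "u t = exp (- c * t) * (w t \<bullet> w t) - \<eta>\<^sup>2 * t" for t
  define u' where "u' t h = h * (exp (- c * t) * (2 * (w t \<bullet> w' t)) - c * exp (- c * t) * (w t \<bullet> w t) - \<eta>\<^sup>2)" for t h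
  have ud: "(u has_derivative u' t) (at t within {0..1})" if t: "t \<in> {0..1}" for t
  proof -
    have [derivative_intros]: "(w has_derivative (\<lambda>h. h *\<^sub>R w' t)) (at t within {0..1})"
      using d[OF t] by (simp add: has_vector_derivative_def)
    show ?thesis unfolding u_def u'_def
      by (auto intro!: derivative_eq_intros simp: fun_eq_iff inner_commute algebra_simps)
  qed
  obtain t where t: "t \<in> {0..1}" "u 1 - u 0 = u' t (1 - 0)"
    using mvt_very_simple[of 0 1 u u'] ud by auto
  have "2 * (w t \<bullet> w' t) \<le> 2 * (norm (w t) * norm (w' t))"
    using norm_cauchy_schwarz[of "w t" "w' t"] by simp
  also have "\<dots> \<le> 2 * (norm (w t) * (L * norm (w t) + \<eta>))"
    using b[OF t(1)] by (intro mult_left_mono) auto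
  also have "\<dots> \<le> c * (norm (w t))\<^sup>2 + \<eta>\<^sup>2"
    using sum_squares_bound[of "norm (w t)" \<eta>] by (simp add: c_def power2_eq_square algebra_simps)
  finally have A: "2 * (w t \<bullet> w' t) - c * (w t \<bullet> w t) \<le> \<eta>\<^sup>2"
    by (simp add: power2_norm_eq_inner)
  have "exp (- c * t) * (2 * (w t \<bullet> w' t) - c * (w t \<bullet> w t)) \<le> exp (- c * t) * \<eta>\<^sup>2"
    using A by (intro mult_left_mono) auto
  also have "\<dots> \<le> 1 * \<eta>\<^sup>2"
    using t nn by (intro mult_right_mono) (auto simp: c_def mult_nonpos_nonneg)
  finally have "u' t 1 \<le> 0" by (simp add: u'_def algebra_simps)
  then have "u 1 \<le> 0" using t w0 by (simp add: u_def)
  then have "exp (- c) * (norm (w 1))\<^sup>2 \<le> \<eta>\<^sup>2" by (simp add: u_def power2_norm_eq_inner)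
  then have "(norm (w 1))\<^sup>2 \<le> \<eta>\<^sup>2 * exp c" by (simp add: exp_minus field_simps)
  also have "\<dots> = (\<eta> * exp (L + 1 / 2))\<^sup>2"
    by (simp add: power_mult_distrib c_def flip: exp_double)
  finally show ?thesis using nn by (simp add: power2_le_iff_abs_le)
qed

text \<open>A step of length \<open>h = 1 / N\<close> commits a local error of at most \<open>L B h\<^sup>2\<close> and amplifies the
  accumulated error by at most \<open>1 + L h\<close>.\<close>

lemma euler_polygon_error:
  fixes V :: "'a::real_normed_vector \<Rightarrow> 'a"
  assumes lip: "\<And>y z. y \<in> K \<Longrightarrow> z \<in> K \<Longrightarrow> norm (V y - V z) \<le> L * norm (y - z)" and L: "L \<ge> 0"
    and B: "\<And>y. y \<in> K \<Longrightarrow> norm (V y) \<le> B"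
    and sol: "\<And>t. t \<in> {0..1::real} \<Longrightarrow> (\<phi> has_vector_derivative V (\<phi> t)) (at t within {0..1})"
    and \<phi>K: "\<And>t. t \<in> {0..1} \<Longrightarrow> \<phi> t \<in> K"
    and y: "y 0 = \<phi> 0" "\<And>j. y (Suc j) = y j + (1 / real N) *\<^sub>R V (y j)" "\<And>j. j \<le> N \<Longrightarrow> y j \<in> K"
    and N: "N > 0"
  shows "norm (y N - \<phi> 1) \<le> L * B * exp L / real N"
proof -
  define h where "h = 1 / real N"
  have h: "h > 0" "real N * h = 1" using N by (auto simp: h_def)
  have B0: "0 \<le> B" using order_trans[OF norm_ge_zero B[OF \<phi>K[of 0]]] by simp
  have "norm (y j - \<phi> (j * h)) \<le> L * B * h\<^sup>2 * j * (1 + L * h) ^ j" if "j \<le> N" for j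
    using that
  proof (induction j)
    case 0
    then show ?case using y by simp
  next
    case (Suc j)
    define t where "t = j * h"
    have "real (Suc j) * h \<le> real N * h" using Suc h by (intro mult_right_mono) auto
    then have t: "0 \<le> t" "t + h \<le> 1" "Suc j * h = t + h" using h by (auto simp: t_def algebra_simps)
    have sub: "{t..t + h} \<subseteq> {0..1}" using t by auto
    have loc: "norm (\<phi> (t + h) - \<phi> t - (t + h - t) *\<^sub>R V (\<phi> t)) \<le> norm (t + h - t) * (L * (B * h))"
    proof (rule vector_differentiable_bound_linearization[where S = "{t..t + h}"])
      fix s assume s: "s \<in> {t..t + h}"
      show "(\<phi> has_vector_derivative V (\<phi> s)) (at s within {t..t + h})"
        using sol s sub by (meson has_vector_derivative_within_subset subsetD)
      have "norm (\<phi> s - \<phi> t) \<le> B * norm (s - t)"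
      proof (rule differentiable_bound[where S = "{t..t + h}" and f' = "\<lambda>s k. k *\<^sub>R V (\<phi> s)"])
        fix r assume r: "r \<in> {t..t + h}"
        show "(\<phi> has_derivative (\<lambda>k. k *\<^sub>R V (\<phi> r))) (at r within {t..t + h})"
          using has_vector_derivative_within_subset[OF sol[of r] sub] r sub
          by (auto simp: has_vector_derivative_def)
        show "onorm (\<lambda>k. k *\<^sub>R V (\<phi> r)) \<le> B"
          using B \<phi>K r sub by (intro onorm_le) (auto simp: mult.commute[of B] intro!: mult_left_mono)
      qed (use s h in auto)
      also have "\<dots> \<le> B * h" using s B0 by (intro mult_left_mono) auto
      finally have "norm (\<phi> s - \<phi> t) \<le> B * h" .
      then show "norm (V (\<phi> s) - V (\<phi> t)) \<le> L * (B * h)"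
        using lip[of "\<phi> s" "\<phi> t"] \<phi>K s sub L h
        by (smt (verit) atLeastAtMost_iff mult_left_mono subsetD)
    qed (use h in \<open>auto simp: closed_segment_eq_real_ivl\<close>)
    have e: "norm (y j - \<phi> t) \<le> L * B * h\<^sup>2 * j * (1 + L * h) ^ j" (is "_ \<le> ?E")
      using Suc by (simp add: t_def)
    have "norm (V (y j) - V (\<phi> t)) \<le> L * norm (y j - \<phi> t)"
      using lip y(3)[of j] \<phi>K[of t] Suc t h by auto
    then have v: "norm (h *\<^sub>R (V (y j) - V (\<phi> t))) \<le> h * (L * norm (y j - \<phi> t))"
      using h by simp
    have "y (Suc j) - \<phi> (t + h) = (y j - \<phi> t) + h *\<^sub>R (V (y j) - V (\<phi> t)) - (\<phi> (t + h) - \<phi> t - h *\<^sub>R V (\<phi> t))"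
      by (simp add: y(2) h_def algebra_simps)
    then have "norm (y (Suc j) - \<phi> (t + h)) \<le> norm (y j - \<phi> t) + h * (L * norm (y j - \<phi> t)) + h * (L * (B * h))"
      using v loc h by (smt (verit) add_diff_cancel_left' norm_triangle_ineq norm_triangle_ineq4 real_norm_def)
    also have "\<dots> = (1 + L * h) * norm (y j - \<phi> t) + L * B * h\<^sup>2"
      by (simp add: algebra_simps power2_eq_square)
    also have "\<dots> \<le> (1 + L * h) * ?E + L * B * h\<^sup>2 * (1 + L * h) ^ Suc j"
    proof (rule add_mono)
      show "(1 + L * h) * norm (y j - \<phi> t) \<le> (1 + L * h) * ?E"
        using e L h by (intro mult_left_mono) auto
      have "1 \<le> (1 + L * h) ^ Suc j" using L h by (intro one_le_power) auto
      then have "L * B * h\<^sup>2 * 1 \<le> L * B * h\<^sup>2 * (1 + L * h) ^ Suc j"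
        using L B0 by (intro mult_left_mono) auto
      then show "L * B * h\<^sup>2 \<le> L * B * h\<^sup>2 * (1 + L * h) ^ Suc j" by simp
    qed
    also have "\<dots> = L * B * h\<^sup>2 * Suc j * (1 + L * h) ^ Suc j"
      by (simp add: algebra_simps)
    finally show ?case using t by simp
  qed
  from this[of N] have "norm (y N - \<phi> 1) \<le> L * B * h\<^sup>2 * N * (1 + L * h) ^ N"
    using h by simp
  also have "\<dots> = L * B * h * (N * h) * (1 + L * h) ^ N"
    by (simp add: power2_eq_square mult_ac)
  also have "\<dots> = L * B * h * (1 + L * h) ^ N"
    using h by simp
  also have "\<dots> \<le> L * B * h * exp L"
  proof (rule mult_left_mono)
    have "(1 + L * h) ^ N \<le> exp (L * h) ^ N"
      using L h by (intro power_mono) (auto simp: exp_ge_add_one_self)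
    also have "\<dots> = exp L" using h by (simp flip: exp_of_nat_mult add: mult.left_commute mult.commute)
    finally show "(1 + L * h) ^ N \<le> exp L" .
  qed (use L B0 h in auto)
  finally show ?thesis by (simp add: h_def)
qed

section \<open>Complex differentiability along curves\<close>

definition cdiff_at :: "(complex ^ 'n \<Rightarrow> complex ^ 'm) \<Rightarrow> complex ^ 'n \<Rightarrow> bool" where
  "cdiff_at f x \<longleftrightarrow> (\<exists>A. (f has_derivative A) (at x) \<and> (\<forall>c v. A (c *s v) = c *s A v))"

lemma holomorphic_map_on_iff_cdiff_at: "holomorphic_map_on f U \<longleftrightarrow> (\<forall>x\<in>U. cdiff_at f x)"
  by (simp add: holomorphic_map_on_def cdiff_at_def)

text \<open>The one-variable theory is applied to components of compositions with curves, and complex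
  differentiability of a map at the points of a curve is exactly what the chain rule asks for.\<close>

definition curve_diff_at :: "(complex \<Rightarrow> complex ^ 'n) \<Rightarrow> complex \<Rightarrow> bool" where
  "curve_diff_at c z \<longleftrightarrow> (\<exists>v. (c has_derivative (\<lambda>h. h *s v)) (at z))"

lemma bounded_bilinear_smult: "bounded_bilinear ((*s) :: complex \<Rightarrow> complex ^ 'n \<Rightarrow> complex ^ 'n)"
proof
  show "\<exists>K. \<forall>a (b :: complex ^ 'n). norm (a *s b) \<le> norm a * norm b * K"
  proof (intro exI allI)
    fix a :: complex and b :: "complex ^ 'n"
    have "norm (a *s b) \<le> real CARD('n) * (cmod a * max_norm b)"
      using norm_le_card_max_norm[of "a *s b"] by (simp add: max_norm_smult)
    also have "\<dots> \<le> real CARD('n) * (cmod a * norm b)"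
      by (intro mult_left_mono max_norm_le_norm) auto
    finally show "norm (a *s b) \<le> norm a * norm b * real CARD('n)" by (simp add: mult_ac)
  qed
qed (auto simp: vec_eq_iff algebra_simps)

lemma cdiff_at_id: "cdiff_at (\<lambda>x. x) z"
  unfolding cdiff_at_def by (intro exI[of _ "\<lambda>h. h"]) auto

lemma cdiff_at_add: "cdiff_at f x \<Longrightarrow> cdiff_at g x \<Longrightarrow> cdiff_at (\<lambda>x. f x + g x) x"
  unfolding cdiff_at_def
proof (elim exE conjE)
  fix A B assume "(f has_derivative A) (at x)" "(g has_derivative B) (at x)"
    and "\<forall>c v. A (c *s v) = c *s A v" "\<forall>c v. B (c *s v) = c *s B v"
  then show "\<exists>A. ((\<lambda>x. f x + g x) has_derivative A) (at x) \<and> (\<forall>c v. A (c *s v) = c *s A v)"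
    by (intro exI[of _ "\<lambda>h. A h + B h"]) (auto intro: has_derivative_add simp: vector_add_ldistrib)
qed

lemma cdiff_at_const: "cdiff_at (\<lambda>_. c) x"
  unfolding cdiff_at_def by (intro exI[of _ "\<lambda>_. 0"]) auto

lemma cdiff_at_smult: "cdiff_at f x \<Longrightarrow> cdiff_at (\<lambda>x. c *s f x) x"
  unfolding cdiff_at_def
proof (elim exE conjE)
  fix A assume "(f has_derivative A) (at x)" and A: "\<forall>c v. A (c *s v) = c *s A v"
  then have "((\<lambda>x. c *s f x) has_derivative (\<lambda>h. c *s A h)) (at x)"
    by (intro bounded_linear.has_derivative[OF bounded_bilinear.bounded_linear_right[OF bounded_bilinear_smult]])
  with A show "\<exists>A. ((\<lambda>x. c *s f x) has_derivative A) (at x) \<and> (\<forall>c v. A (c *s v) = c *s A v)"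
    by (intro exI[of _ "\<lambda>h. c *s A h"]) (auto simp: vector_smult_assoc mult.commute)
qed

lemma cdiff_at_diff: "cdiff_at f x \<Longrightarrow> cdiff_at g x \<Longrightarrow> cdiff_at (\<lambda>x. f x - g x) x"
  using cdiff_at_add[of f x "\<lambda>x. (-1) *s g x"] cdiff_at_smult[of g x "-1"] by simp

lemma cdiff_at_sum: "(\<And>i. i \<in> I \<Longrightarrow> cdiff_at (f i) x) \<Longrightarrow> cdiff_at (\<lambda>x. \<Sum>i\<in>I. f i x) x"
  by (induction I rule: infinite_finite_induct) (auto intro: cdiff_at_const cdiff_at_add)

lemma cdiff_at_compose: "cdiff_at g (f x) \<Longrightarrow> cdiff_at f x \<Longrightarrow> cdiff_at (\<lambda>x. g (f x)) x"
  unfolding cdiff_at_def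
proof (elim exE conjE)
  fix A B assume "(g has_derivative A) (at (f x))" "(f has_derivative B) (at x)"
    and "\<forall>c v. A (c *s v) = c *s A v" "\<forall>c v. B (c *s v) = c *s B v"
  then show "\<exists>A. ((\<lambda>x. g (f x)) has_derivative A) (at x) \<and> (\<forall>c v. A (c *s v) = c *s A v)"
    by (intro exI[of _ "\<lambda>h. A (B h)"]) (auto intro: has_derivative_compose)
qed

lemma curve_diff_at_compose: "cdiff_at g (c z) \<Longrightarrow> curve_diff_at c z \<Longrightarrow> curve_diff_at (\<lambda>z. g (c z)) z"
  unfolding cdiff_at_def curve_diff_at_def
proof (elim exE conjE)
  fix A v assume A: "(g has_derivative A) (at (c z))" "\<forall>c v. A (c *s v) = c *s A v"
    and "(c has_derivative (\<lambda>h. h *s v)) (at z)"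
  from has_derivative_compose[OF this(3) A(1)] A(2)
  show "\<exists>v. ((\<lambda>z. g (c z)) has_derivative (\<lambda>h. h *s v)) (at z)"
    by (intro exI[of _ "A v"]) simp
qed

lemma curve_diff_at_const: "curve_diff_at (\<lambda>_. x) z"
  unfolding curve_diff_at_def by (intro exI[of _ 0]) simp

lemma curve_diff_at_add: "curve_diff_at c z \<Longrightarrow> curve_diff_at d z \<Longrightarrow> curve_diff_at (\<lambda>z. c z + d z) z"
  unfolding curve_diff_at_def
proof (elim exE)
  fix v w assume "(c has_derivative (\<lambda>h. h *s v)) (at z)" "(d has_derivative (\<lambda>h. h *s w)) (at z)"
  from has_derivative_add[OF this] show "\<exists>v. ((\<lambda>z. c z + d z) has_derivative (\<lambda>h. h *s v)) (at z)"
    by (intro exI[of _ "v + w"]) (simp add: vector_add_ldistrib)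
qed

lemma curve_diff_at_smult:
  assumes "a field_differentiable at z" "curve_diff_at c z"
  shows "curve_diff_at (\<lambda>z. a z *s c z) z"
proof -
  obtain a' v where a: "(a has_derivative (*) a') (at z)" and v: "(c has_derivative (\<lambda>h. h *s v)) (at z)"
    using assms unfolding field_differentiable_def curve_diff_at_def has_field_derivative_def by blast
  have "((\<lambda>z. a z *s c z) has_derivative (\<lambda>h. h *s (a z *s v + a' *s c z))) (at z)"
    by (rule has_derivative_eq_rhs[OF bounded_bilinear.FDERIV[OF bounded_bilinear_smult a v]])
      (auto simp: vec_eq_iff algebra_simps)
  then show ?thesis unfolding curve_diff_at_def by blast
qed

lemma curve_diff_at_diff: "curve_diff_at c z \<Longrightarrow> curve_diff_at d z \<Longrightarrow> curve_diff_at (\<lambda>z. c z - d z) z"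
  using curve_diff_at_add[of c z "\<lambda>z. (-1) *s d z"] curve_diff_at_smult[of "\<lambda>_. -1" z d] by simp

lemma curve_diff_at_sum: "(\<And>i. i \<in> I \<Longrightarrow> curve_diff_at (c i) z) \<Longrightarrow> curve_diff_at (\<lambda>z. \<Sum>i\<in>I. c i z) z"
  by (induction I rule: infinite_finite_induct) (auto intro: curve_diff_at_const curve_diff_at_add)

lemma curve_diff_at_component:
  assumes "curve_diff_at c z"
  shows "(\<lambda>z. c z $ i) field_differentiable at z"
proof -
  obtain v where "(c has_derivative (\<lambda>h. h *s v)) (at z)" using assms by (auto simp: curve_diff_at_def)
  from bounded_linear.has_derivative[OF bounded_linear_vec_nth this, of i]
  have "((\<lambda>z. c z $ i) has_field_derivative v $ i) (at z)"
    unfolding has_field_derivative_def by (rule has_derivative_eq_rhs) (auto simp: mult.commute)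
  then show ?thesis by (auto simp: field_differentiable_def)
qed

lemma curve_component_holomorphic:
  "(\<And>z. z \<in> S \<Longrightarrow> curve_diff_at c z) \<Longrightarrow> (\<lambda>z. c z $ i) holomorphic_on S"
  by (auto simp: holomorphic_on_def intro!: field_differentiable_at_within curve_diff_at_component)

section \<open>Neighbourhoods and finite differences\<close>

lemma complex_nbhd_mono: "r \<le> s \<Longrightarrow> complex_nbhd D r \<subseteq> complex_nbhd D s"
  by (force simp: complex_nbhd_def)

lemma complex_nbhd_add:
  assumes "y \<in> complex_nbhd D r" "max_norm v \<le> s"
  shows "y + v \<in> complex_nbhd D (r + s)"
proof -
  obtain x where x: "x \<in> D" "max_norm (y - x) < r" using assms by (auto simp: complex_nbhd_def)
  have "max_norm (y + v - x) \<le> max_norm (y - x) + max_norm v"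
    using max_norm_triangle[of "y - x" v] by (simp add: algebra_simps)
  with x assms show ?thesis by (force simp: complex_nbhd_def)
qed

lemma complex_nbhdI: "x \<in> D \<Longrightarrow> max_norm (y - x) < r \<Longrightarrow> y \<in> complex_nbhd D r"
  by (auto simp: complex_nbhd_def)

text \<open>If the increment \<open>v\<close> is shorter than \<open>\<rho>\<close>, the complex line \<open>y + z v\<close> stays in the domain for
  \<open>|z| < \<rho> / |v|\<close>, and \<open>h (y + z v) - h y\<close> is bounded by \<open>2 B\<close> there and vanishes at 0: the Schwarz
  lemma at \<open>z = 1\<close> applies. For longer increments the estimate is weaker than the bound \<open>2 B\<close>.\<close>

lemma increment_bound:
  assumes h: "\<And>w. w \<in> complex_nbhd D r \<Longrightarrow> cdiff_at h w"
    and B: "\<And>w. w \<in> complex_nbhd D r \<Longrightarrow> max_norm (h w) \<le> B"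
    and y: "y \<in> complex_nbhd D (r - \<rho>)" "y' \<in> complex_nbhd D r" and \<rho>: "0 < \<rho>"
  shows "max_norm (h y' - h y) \<le> 2 * B / \<rho> * max_norm (y' - y)"
proof -
  define v where "v = y' - y"
  have yr: "y \<in> complex_nbhd D r" using complex_nbhd_mono[of "r - \<rho>" r D] y \<rho> by auto
  have B0: "0 \<le> B" using B[OF yr] max_norm_nonneg[of "h y"] by linarith
  have B2: "max_norm (h w - h y) \<le> 2 * B" if "w \<in> complex_nbhd D r" for w
    using max_norm_diff_triangle[of "h w" "h y"] B[OF that] B[OF yr] by linarith
  show ?thesis
  proof (cases "max_norm v < \<rho> \<and> v \<noteq> 0")
    case True
    then have v: "0 < max_norm v" "max_norm v < \<rho>"
      using max_norm_eq_0D[of v] by (auto simp: not_le[symmetric])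
    define R where "R = \<rho> / max_norm v"
    have R: "1 < R" using v by (simp add: R_def)
    have mem: "y + z *s v \<in> complex_nbhd D r" if "z \<in> ball 0 R" for z
    proof -
      have "max_norm (z *s v) \<le> \<rho>"
        using that v by (simp add: max_norm_smult R_def field_simps)
      from complex_nbhd_add[OF y(1) this] show ?thesis by simp
    qed
    show ?thesis unfolding max_norm_le_iff
    proof
      fix i
      define q where "q z = (h (y + z *s v) - h y) $ i" for z
      have "cmod (q 1) \<le> 2 * B * (\<Prod>a\<in>{0}. cmod (1 - a) / (R - cmod a))"
      proof (rule schwarz_lemma_nodes)
        show "q holomorphic_on ball 0 R" unfolding q_def
          by (intro curve_component_holomorphic curve_diff_at_diff curve_diff_at_const
              curve_diff_at_compose[OF h] mem curve_diff_at_add curve_diff_at_smult) (auto intro: field_differentiable_ident)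
        show "cmod (q z) \<le> 2 * B" if "z \<in> ball 0 R" for z
          using B2[OF mem[OF that]] by (simp add: q_def max_norm_le_iff)
      qed (use R in \<open>auto simp: q_def\<close>)
      then show "cmod ((h y' - h y) $ i) \<le> 2 * B / \<rho> * max_norm (y' - y)"
        by (simp add: q_def R_def v_def)
    qed
  next
    case False
    show ?thesis
    proof (cases "v = 0")
      case False
      with \<open>\<not> (max_norm v < \<rho> \<and> v \<noteq> 0)\<close> have "1 \<le> max_norm v / \<rho>" using \<rho> by simp
      then have "2 * B * 1 \<le> 2 * B * (max_norm v / \<rho>)" using B0 by (intro mult_left_mono) auto
      then show ?thesis using B2[OF y(2)] by (simp add: v_def)
    qed (simp add: v_def)
  qed
qed

lemma iterate_defined_at_Suc:
  "iterate_defined_at f U (Suc k) x \<longleftrightarrow> x \<in> U \<and> iterate_defined_at f U k (f x)"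
  by (auto simp: iterate_defined_at_def less_Suc_eq_0_disj funpow_swap1 simp flip: funpow_swap1)

lemma iterate_defined_at_mono: "iterate_defined_at f U k x \<Longrightarrow> j \<le> k \<Longrightarrow> iterate_defined_at f U j x"
  by (auto simp: iterate_defined_at_def)

text \<open>A finite difference of order \<open>k\<close> evaluates \<open>f\<close> only at the first \<open>k\<close> points of the orbit,
  and these points are what \<^const>\<open>iterate_defined_at\<close> controls.\<close>

lemma cdiff_at_fin_diff:
  assumes "holomorphic_map_on f U" "iterate_defined_at f U k x"
  shows "cdiff_at (fin_diff f k) x"
  using assms(2)
proof (induction k arbitrary: x)
  case 0
  have "fin_diff f 0 = (\<lambda>x. x)" by (simp add: fun_eq_iff)
  then show ?case by (simp only: cdiff_at_id)
next
  case (Suc k)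
  have "cdiff_at (\<lambda>x. fin_diff f k (f x) - fin_diff f k x) x"
  proof (rule cdiff_at_diff)
    show "cdiff_at (\<lambda>x. fin_diff f k (f x)) x"
      by (rule cdiff_at_compose[where g = "fin_diff f k" and f = f])
        (use Suc assms(1) in \<open>auto simp: iterate_defined_at_Suc holomorphic_map_on_iff_cdiff_at\<close>)
    show "cdiff_at (fin_diff f k) x"
      using Suc iterate_defined_at_mono[OF Suc.prems] by simp
  qed
  moreover have "fin_diff f (Suc k) = (\<lambda>x. fin_diff f k (f x) - fin_diff f k x)"
    by (simp add: fun_eq_iff)
  ultimately show ?case by (simp only:)
qed

text \<open>Newton's forward difference formula: the shift along orbits is the identity plus the difference
  operator, and its powers expand by the binomial theorem.\<close>

lemma fin_diff_iterate:
  "fin_diff f j ((f ^^ i) x) = (\<Sum>k\<le>i. real (i choose k) *\<^sub>R fin_diff f (j + k) x)"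
proof (induction i arbitrary: j x)
  case (Suc i)
  have "fin_diff f j ((f ^^ Suc i) x) = fin_diff f j ((f ^^ i) (f x))"
    by (simp add: funpow_swap1)
  also have "\<dots> = (\<Sum>k\<le>i. real (i choose k) *\<^sub>R fin_diff f (j + k) (f x))" by (rule Suc)
  also have "\<dots> = (\<Sum>k\<le>i. real (i choose k) *\<^sub>R fin_diff f (j + Suc k) x)
      + (\<Sum>k\<le>i. real (i choose k) *\<^sub>R fin_diff f (j + k) x)"
    by (simp add: algebra_simps flip: sum.distrib)
  also have "(\<Sum>k\<le>i. real (i choose k) *\<^sub>R fin_diff f (j + k) x) =
      (\<Sum>k\<le>Suc i. real (i choose k) *\<^sub>R fin_diff f (j + k) x)" by simp
  also have "\<dots> = fin_diff f j x + (\<Sum>k\<le>i. real (i choose Suc k) *\<^sub>R fin_diff f (j + Suc k) x)"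
    by (subst sum.atMost_Suc_shift) simp
  also have "(\<Sum>k\<le>i. real (i choose k) *\<^sub>R fin_diff f (j + Suc k) x) +
      (fin_diff f j x + (\<Sum>k\<le>i. real (i choose Suc k) *\<^sub>R fin_diff f (j + Suc k) x)) =
      fin_diff f j x + (\<Sum>k\<le>i. real (Suc i choose Suc k) *\<^sub>R fin_diff f (j + Suc k) x)"
    by (simp add: algebra_simps flip: sum.distrib)
  also have "\<dots> = (\<Sum>k\<le>Suc i. real (Suc i choose k) *\<^sub>R fin_diff f (j + k) x)"
    by (simp add: sum.atMost_Suc_shift del: sum.atMost_Suc binomial_Suc_Suc)
  finally show ?case .
qed simp

lemma interp_field_alt:
  "interp_field f m x = (\<Sum>k<m. ((-1) ^ k / real (Suc k)) *\<^sub>R fin_diff f (Suc k) x)"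
  unfolding interp_field_def
  by (rule sum.reindex_bij_witness[of _ Suc "\<lambda>k. k - 1"]) auto

section \<open>The linear family through a near-identity map\<close>

text \<open>The map \<open>g\<close> is the normalised displacement of the given map; \<open>\<mu>\<close> scales it.\<close>

locale displacement =
  fixes D0 :: "(complex ^ 'n) set" and \<delta> :: real and g :: "complex ^ 'n \<Rightarrow> complex ^ 'n"
  assumes \<delta>_pos: "0 < \<delta>"
    and g_holo: "holomorphic_map_on g (complex_nbhd D0 \<delta>)"
    and g_bound: "\<And>x. x \<in> complex_nbhd D0 \<delta> \<Longrightarrow> max_norm (g x) \<le> 1"
begin

abbreviation U where "U r \<equiv> complex_nbhd D0 r"

definition F :: "complex \<Rightarrow> complex ^ 'n \<Rightarrow> complex ^ 'n" where "F \<mu> x = x + \<mu> *s g x"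

lemma F_holo: "holomorphic_map_on (F \<mu>) (U \<delta>)"
  using g_holo unfolding F_def holomorphic_map_on_iff_cdiff_at
  by (simp add: cdiff_at_add[OF cdiff_at_id cdiff_at_smult])

lemma F_displacement: "x \<in> U \<delta> \<Longrightarrow> max_norm (F \<mu> x - x) \<le> cmod \<mu>"
  using g_bound by (simp add: F_def max_norm_smult mult_left_le)

lemma F_mem: "y \<in> U r \<Longrightarrow> r \<le> \<delta> \<Longrightarrow> F \<mu> y \<in> U (r + cmod \<mu>)"
  using complex_nbhd_add[of y D0 r "F \<mu> y - y"] F_displacement[of y \<mu>] complex_nbhd_mono[of r \<delta> D0] by auto

lemma iterate_mem: "y \<in> U r \<Longrightarrow> r + real j * cmod \<mu> \<le> \<delta> \<Longrightarrow> (F \<mu> ^^ j) y \<in> U (r + real j * cmod \<mu>)"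
proof (induction j)
  case (Suc j)
  have le: "r + real j * cmod \<mu> \<le> \<delta>" using Suc.prems by (simp add: algebra_simps) (smt (verit) norm_ge_zero)
  show ?case using F_mem[OF Suc.IH[OF Suc.prems(1) le] le, of \<mu>] by (simp add: algebra_simps)
qed simp

lemma iterates_defined:
  assumes "y \<in> U r" "\<And>j. j < k \<Longrightarrow> r + real j * cmod \<mu> \<le> \<delta>"
  shows "iterate_defined_at (F \<mu>) (U \<delta>) k y"
  unfolding iterate_defined_at_def
  using iterate_mem[OF assms(1)] assms(2) complex_nbhd_mono by blast

lemma curve_diff_at_F:
  assumes "a field_differentiable at z" "curve_diff_at y z" "y z \<in> U \<delta>"
  shows "curve_diff_at (\<lambda>w. F (a w) (y w)) z"
  unfolding F_def using assms g_holo
  by (intro curve_diff_at_add curve_diff_at_smult curve_diff_at_compose[of g])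
    (auto simp: holomorphic_map_on_iff_cdiff_at)

text \<open>Parameter and point move together along the curve. This covers the dependence on \<open>\<mu>\<close> of a
  composition such as an Euler polygon, where the point depends on \<open>\<mu>\<close> as well.\<close>

lemma curve_diff_at_fin_diff:
  assumes "a field_differentiable at z" "curve_diff_at y z" "iterate_defined_at (F (a z)) (U \<delta>) k (y z)"
  shows "curve_diff_at (\<lambda>w. fin_diff (F (a w)) k (y w)) z"
  using assms(2,3)
proof (induction k arbitrary: y)
  case (Suc k)
  have "curve_diff_at (\<lambda>w. fin_diff (F (a w)) k (F (a w) (y w)) - fin_diff (F (a w)) k (y w)) z"
  proof (rule curve_diff_at_diff)
    show "curve_diff_at (\<lambda>w. fin_diff (F (a w)) k (F (a w) (y w))) z"
      using Suc.prems assms(1) by (intro Suc.IH curve_diff_at_F) (auto simp: iterate_defined_at_Suc)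
    show "curve_diff_at (\<lambda>w. fin_diff (F (a w)) k (y w)) z"
      using Suc.prems iterate_defined_at_mono[OF Suc.prems(2)] by (intro Suc.IH) auto
  qed
  then show ?case by simp
qed simp

text \<open>The next difference is the increment of the current one over the step from \<open>y\<close> to \<open>F \<mu> y\<close>, whose
  length is at most \<open>|\<mu>|\<close>. By \<open>increment_bound\<close> each order gains a factor \<open>2 |\<mu>| / \<rho>\<close> and loses \<open>\<rho>\<close> of
  the radius. This is the source both of the quantitative bound on the field and of
  \<open>\<Delta>_k = O(|\<mu>| ^ k)\<close>.\<close>

lemma fin_diff_bound:
  assumes \<rho>: "0 < \<rho>" "cmod \<mu> \<le> \<rho>"
  shows "y \<in> U (\<delta> - real k * \<rho>) \<Longrightarrow> max_norm (fin_diff (F \<mu>) (Suc k) y) \<le> cmod \<mu> * (2 * cmod \<mu> / \<rho>) ^ k"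
proof (induction k arbitrary: y)
  case 0
  then show ?case using F_displacement by simp
next
  case (Suc k)
  let ?r = "\<delta> - real k * \<rho>" and ?B = "cmod \<mu> * (2 * cmod \<mu> / \<rho>) ^ k"
  have y: "y \<in> U (?r - \<rho>)" using Suc.prems by (simp add: algebra_simps)
  have le: "?r - \<rho> \<le> \<delta>" using \<rho> mult_nonneg_nonneg[of "real k" \<rho>] by linarith
  have y\<delta>: "y \<in> U \<delta>" using y complex_nbhd_mono[OF le] by blast
  have y': "F \<mu> y \<in> U ?r"
    using F_mem[OF y le, of \<mu>] complex_nbhd_mono[of "?r - \<rho> + cmod \<mu>" ?r D0] \<rho> by auto
  have "max_norm (fin_diff (F \<mu>) (Suc k) (F \<mu> y) - fin_diff (F \<mu>) (Suc k) y) \<le> 2 * ?B / \<rho> * max_norm (F \<mu> y - y)"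
  proof (rule increment_bound[OF _ _ y y' \<rho>(1)])
    fix w assume w: "w \<in> U ?r"
    show "max_norm (fin_diff (F \<mu>) (Suc k) w) \<le> ?B" using Suc.IH[OF w] .
    have "iterate_defined_at (F \<mu>) (U \<delta>) (Suc k) w"
    proof (rule iterates_defined[OF w])
      fix j assume "j < Suc k"
      then have "real j * cmod \<mu> \<le> real k * \<rho>" using \<rho> by (intro mult_mono) auto
      then show "?r + real j * cmod \<mu> \<le> \<delta>" by simp
    qed
    then show "cdiff_at (fin_diff (F \<mu>) (Suc k)) w" by (rule cdiff_at_fin_diff[OF F_holo])
  qed
  also have "\<dots> \<le> 2 * ?B / \<rho> * cmod \<mu>"
    using F_displacement[OF y\<delta>] \<rho> by (intro mult_left_mono) auto
  finally show ?case by (simp add: mult_ac)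
qed

end

section \<open>The interpolating vector field and its flow\<close>

lemma cdiff_at_isCont: "cdiff_at f x \<Longrightarrow> isCont f x"
  unfolding cdiff_at_def using has_derivative_continuous by blast

locale interpolation = displacement D0 \<delta> g
  for D0 :: "(complex ^ 'n) set" and \<delta> :: real and g :: "complex ^ 'n \<Rightarrow> complex ^ 'n" +
  fixes m :: nat
  assumes m_ge_2: "2 \<le> m"
begin

text \<open>This is the radius of the parameter disc on which the argument works: for \<open>|\<mu>| \<le> \<mu>max\<close> a point
  of \<open>D_(\<delta>/3)\<close> is moved by at most \<open>\<delta> / 6\<close> in \<open>m - 1\<close> steps, and one also has \<open>2 |\<mu>| \<le> \<delta> / 3\<close>.\<close>

definition \<mu>max :: real where "\<mu>max = \<delta> / (6 * (real m - 1))"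

abbreviation X where "X \<mu> \<equiv> interp_field (F \<mu>) m"

abbreviation solution where "solution \<mu> x \<equiv> solves_ivp (U (\<delta> / 3)) (X \<mu>) x 1"

abbreviation time_one where "time_one \<mu> x \<equiv> flow (U (\<delta> / 3)) (X \<mu>) 1 x"

lemma \<mu>max_pos: "0 < \<mu>max"
  using m_ge_2 \<delta>_pos by (simp add: \<mu>max_def)

lemma \<mu>max_mult: "(real m - 1) * \<mu>max = \<delta> / 6"
proof -
  define a where "a = real m - 1"
  have "a \<noteq> 0" using m_ge_2 by (simp add: a_def)
  then show ?thesis unfolding \<mu>max_def a_def[symmetric] by simp
qed

lemma \<mu>max_le: "2 * \<mu>max \<le> \<delta> / 3"
proof -
  have "1 * \<mu>max \<le> (real m - 1) * \<mu>max"
    using m_ge_2 \<mu>max_pos by (intro mult_right_mono) auto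
  then show ?thesis using \<mu>max_mult by simp
qed

lemma iterates_defined_third:
  assumes "y \<in> U (\<delta> / 3)" "cmod \<mu> \<le> \<mu>max" "i \<le> m"
  shows "iterate_defined_at (F \<mu>) (U \<delta>) i y"
proof (rule iterates_defined[OF assms(1)])
  fix j assume "j < i"
  then have "real j * cmod \<mu> \<le> (real m - 1) * \<mu>max"
    using assms by (intro mult_mono) auto
  then show "\<delta> / 3 + real j * cmod \<mu> \<le> \<delta>" using \<mu>max_mult \<delta>_pos by simp
qed

text \<open>The \<open>m - 1\<close> Schwarz estimates leading to \<open>\<Delta>_m\<close> share the available distance \<open>2 \<delta> / 3\<close> equally, so
  each uses \<open>\<rho> = 2 \<delta> / (3 (m - 1)) = 4 \<mu>max\<close>. Then each order gains a factor \<open>1 / 2\<close>, and the sum is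
  dominated by a geometric series.\<close>

lemma X_bound:
  assumes "y \<in> U (\<delta> / 3)" "cmod \<mu> \<le> \<mu>max"
  shows "max_norm (X \<mu> y) \<le> 2 * cmod \<mu>"
proof -
  define \<rho> where "\<rho> = 4 * \<mu>max"
  have \<rho>: "0 < \<rho>" "cmod \<mu> \<le> \<rho>" using \<mu>max_pos assms(2) by (auto simp: \<rho>_def)
  have le: "2 * cmod \<mu> / \<rho> \<le> 1 / 2" using assms(2) \<mu>max_pos by (simp add: \<rho>_def field_simps)
  have "max_norm (X \<mu> y) \<le> (\<Sum>k<m. max_norm (((-1) ^ k / real (Suc k)) *\<^sub>R fin_diff (F \<mu>) (Suc k) y))"
    unfolding interp_field_alt by (rule max_norm_sum)
  also have "\<dots> \<le> (\<Sum>k<m. cmod \<mu> * (1 / 2) ^ k)"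
  proof (rule sum_mono)
    fix k assume "k \<in> {..<m}"
    then have "real k * \<rho> \<le> (real m - 1) * \<rho>" using \<rho> by (intro mult_right_mono) auto
    also have "\<dots> = 4 * ((real m - 1) * \<mu>max)" by (simp add: \<rho>_def)
    finally have "\<delta> / 3 \<le> \<delta> - real k * \<rho>" unfolding \<mu>max_mult by simp
    then have y: "y \<in> U (\<delta> - real k * \<rho>)" using assms(1) complex_nbhd_mono by blast
    have "max_norm (((-1) ^ k / real (Suc k)) *\<^sub>R fin_diff (F \<mu>) (Suc k) y)
        = max_norm (fin_diff (F \<mu>) (Suc k) y) / real (Suc k)"
      by (simp add: max_norm_scaleR power_abs del: of_nat_Suc fin_diff.simps)
    also have "\<dots> \<le> max_norm (fin_diff (F \<mu>) (Suc k) y)"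
      using max_norm_nonneg[of "fin_diff (F \<mu>) (Suc k) y"]
      by (simp add: divide_le_eq mult_left_le algebra_simps del: fin_diff.simps)
    also have "\<dots> \<le> cmod \<mu> * (2 * cmod \<mu> / \<rho>) ^ k" by (rule fin_diff_bound[OF \<rho> y])
    also have "\<dots> \<le> cmod \<mu> * (1 / 2) ^ k"
      using le \<rho> by (intro mult_left_mono power_mono) auto
    finally show "max_norm (((-1) ^ k / real (Suc k)) *\<^sub>R fin_diff (F \<mu>) (Suc k) y) \<le> cmod \<mu> * (1 / 2) ^ k" .
  qed
  also have "\<dots> = cmod \<mu> * (2 - 2 * (1 / 2) ^ m)"
    unfolding sum_distrib_left[symmetric] by (subst sum_gp_strict) (simp add: field_simps)
  also have "\<dots> \<le> cmod \<mu> * 2" by (intro mult_left_mono) auto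
  finally show ?thesis by simp
qed

lemma cdiff_at_X:
  assumes "y \<in> U (\<delta> / 3)" "cmod \<mu> \<le> \<mu>max"
  shows "cdiff_at (X \<mu>) y"
  unfolding interp_field_def scaleR_eq_smult
  by (intro cdiff_at_sum cdiff_at_smult cdiff_at_fin_diff[OF F_holo] iterates_defined_third assms) auto

lemma continuous_on_X: "cmod \<mu> \<le> \<mu>max \<Longrightarrow> continuous_on (U (\<delta> / 3)) (X \<mu>)"
  by (intro continuous_at_imp_continuous_on ballI cdiff_at_isCont cdiff_at_X)

lemma curve_diff_at_X:
  assumes "curve_diff_at y z" "y z \<in> U (\<delta> / 3)" "cmod z \<le> \<mu>max"
  shows "curve_diff_at (\<lambda>\<mu>. X \<mu> (y \<mu>)) z"
  unfolding interp_field_def scaleR_eq_smult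
  by (intro curve_diff_at_sum curve_diff_at_smult curve_diff_at_fin_diff iterates_defined_third assms
      field_differentiable_const field_differentiable_ident) auto

lemma X_lipschitz:
  assumes "y \<in> U (\<delta> / 3 - \<rho>)" "y' \<in> U (\<delta> / 3 - \<rho>)" "cmod \<mu> \<le> \<mu>max" "0 < \<rho>"
  shows "norm (X \<mu> y' - X \<mu> y) \<le> (real CARD('n) * 4 * \<mu>max / \<rho>) * norm (y' - y)"
proof -
  have y': "y' \<in> U (\<delta> / 3)" using assms(2,4) complex_nbhd_mono[of "\<delta> / 3 - \<rho>" "\<delta> / 3" D0] by auto
  have "max_norm (X \<mu> y' - X \<mu> y) \<le> 2 * (2 * cmod \<mu>) / \<rho> * max_norm (y' - y)"
    using cdiff_at_X X_bound assms(3) by (intro increment_bound[OF _ _ assms(1) y' assms(4)]) auto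
  also have "\<dots> \<le> 2 * (2 * \<mu>max) / \<rho> * norm (y' - y)"
    using assms \<mu>max_pos by (intro mult_mono divide_right_mono max_norm_le_norm max_norm_nonneg) auto
  finally have "real CARD('n) * max_norm (X \<mu> y' - X \<mu> y) \<le> real CARD('n) * (2 * (2 * \<mu>max) / \<rho> * norm (y' - y))"
    by (intro mult_left_mono) auto
  with norm_le_card_max_norm[of "X \<mu> y' - X \<mu> y"] show ?thesis by simp
qed

lemma solution_iff:
  "solution \<mu> x \<phi> \<longleftrightarrow> \<phi> 0 = x \<and> (\<forall>s\<in>{0..1}. \<phi> s \<in> U (\<delta> / 3) \<and>
    (\<phi> has_vector_derivative X \<mu> (\<phi> s)) (at s within {0..1}))"
  by (simp add: solves_ivp_def closed_segment_eq_real_ivl)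

text \<open>The closed ball of radius \<open>2 |\<mu>|\<close> is invariant under the Picard operator by the bound on the field,
  and it has positive distance to the complement of \<open>D_(\<delta>/3)\<close>, which gives a uniform Lipschitz
  constant.\<close>

lemma solution_exists:
  assumes x: "x \<in> D0" and \<mu>: "cmod \<mu> < \<mu>max"
  obtains \<phi> where "solution \<mu> x \<phi>"
proof -
  define K where "K = {y. max_norm (y - x) \<le> 2 * cmod \<mu>}"
  define \<rho> where "\<rho> = \<mu>max - cmod \<mu>"
  define L where "L = real CARD('n) * 4 * \<mu>max / \<rho>"
  have \<rho>: "0 < \<rho>" "2 * cmod \<mu> < \<delta> / 3 - \<rho>" using \<mu> \<mu>max_le by (auto simp: \<rho>_def)
  have L: "L > 0" using \<rho> \<mu>max_pos by (simp add: L_def)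
  have KU: "K \<subseteq> U (\<delta> / 3 - \<rho>)" using x \<rho> by (auto simp: K_def intro: complex_nbhdI)
  have KU': "K \<subseteq> U (\<delta> / 3)"
    using KU complex_nbhd_mono[of "\<delta> / 3 - \<rho>" "\<delta> / 3" D0] \<rho> by auto
  obtain \<phi> where "\<phi> 0 = x" "\<And>t. t \<in> {0..1::real} \<Longrightarrow> \<phi> t \<in> K"
    "\<And>t. t \<in> {0..1} \<Longrightarrow> (\<phi> has_vector_derivative X \<mu> (\<phi> t)) (at t within {0..1})"
  proof (rule picard_lindelof[of K x L "X \<mu>"])
    show "closed K" unfolding K_def by (rule closed_max_norm_ball)
    show "x \<in> K" by (simp add: K_def)
    show "norm (X \<mu> y - X \<mu> z) \<le> L * norm (y - z)" if "y \<in> K" "z \<in> K" for y z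
      unfolding L_def using that KU \<mu> \<rho> by (intro X_lipschitz) auto
    fix \<psi> :: "real \<Rightarrow> complex ^ 'n" and t :: real
    assume \<psi>: "continuous_on {0..1} \<psi>" "\<psi> ` {0..1} \<subseteq> K" and t: "t \<in> {0..1}"
    have "continuous_on {0..t} (\<lambda>s. X \<mu> (\<psi> s))"
    proof (rule continuous_on_compose2[OF continuous_on_X])
      show "continuous_on {0..t} \<psi>" using \<psi>(1) t by (auto intro: continuous_on_subset)
      show "\<psi> ` {0..t} \<subseteq> U (\<delta> / 3)" using \<psi>(2) KU' t by fastforce
    qed (use \<mu> in auto)
    then have d: "((\<lambda>u. integral {0..u} (\<lambda>s. X \<mu> (\<psi> s))) has_vector_derivative X \<mu> (\<psi> s)) (at s within {0..t})"
      if "s \<in> {0..t}" for s using that by (rule integral_has_vector_derivative)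
    have "max_norm (integral {0..t} (\<lambda>s. X \<mu> (\<psi> s)) - integral {0..0} (\<lambda>s. X \<mu> (\<psi> s))) \<le> 2 * cmod \<mu> * t"
    proof (rule max_norm_mean_value[OF d])
      fix s assume "s \<in> {0..t}"
      then have "\<psi> s \<in> U (\<delta> / 3)" using \<psi>(2) KU' t by fastforce
      then show "max_norm (X \<mu> (\<psi> s)) \<le> 2 * cmod \<mu>" using X_bound \<mu> by simp
    qed (use t in auto)
    also have "\<dots> \<le> 2 * cmod \<mu>" using t by (simp add: mult_left_le)
    finally show "x + integral {0..t} (\<lambda>s. X \<mu> (\<psi> s)) \<in> K" by (simp add: K_def)
  qed (use L in auto)
  then have "solution \<mu> x \<phi>" using KU' by (auto simp: solution_iff)
  then show ?thesis by (rule that)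
qed

lemma solution_stays:
  assumes "solution \<mu> x \<phi>" "cmod \<mu> \<le> \<mu>max" "t \<in> {0..1}"
  shows "max_norm (\<phi> t - x) \<le> 2 * cmod \<mu> * t"
proof -
  have "max_norm (\<phi> t - \<phi> 0) \<le> 2 * cmod \<mu> * t"
  proof (rule max_norm_mean_value)
    fix s assume s: "s \<in> {0..t}"
    have s1: "s \<in> {0..1}" "{0..t} \<subseteq> {0..1}" using s assms(3) by auto
    show "(\<phi> has_vector_derivative X \<mu> (\<phi> s)) (at s within {0..t})"
      by (rule has_vector_derivative_within_subset[OF _ s1(2)])
        (use assms(1)[unfolded solution_iff] s1(1) in blast)
    show "max_norm (X \<mu> (\<phi> s)) \<le> 2 * cmod \<mu>"
      using assms(1) s1 by (intro X_bound assms(2)) (auto simp: solution_iff)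
  qed (use assms in auto)
  then show ?thesis using assms(1) by (simp add: solution_iff)
qed

text \<open>Used for uniqueness of solutions (with defect \<open>\<eta> = 0\<close>) and for comparing the flow with the
  interpolation polynomial.\<close>

lemma approximate_solution:
  assumes x: "x \<in> D0" and sol: "solution \<mu> x \<phi>" and \<mu>: "cmod \<mu> \<le> \<mu>max"
    and r: "2 * cmod \<mu> \<le> r" "r < \<delta> / 3 - \<rho>" "0 < \<rho>"
    and P: "P 0 = x" "\<And>t. t \<in> {0..1} \<Longrightarrow> max_norm (P t - x) \<le> r"
      "\<And>t. t \<in> {0..1} \<Longrightarrow> (P has_vector_derivative P' t) (at t within {0..1})"
    and \<eta>: "\<And>t. t \<in> {0..1} \<Longrightarrow> norm (P' t - X \<mu> (P t)) \<le> \<eta>"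
  shows "norm (P 1 - \<phi> 1) \<le> \<eta> * exp (real CARD('n) * 4 * \<mu>max / \<rho> + 1 / 2)"
proof -
  let ?L = "real CARD('n) * 4 * \<mu>max / \<rho>"
  have \<eta>0: "0 \<le> \<eta>" using order_trans[OF norm_ge_zero \<eta>[of 0]] by simp
  have "norm ((\<lambda>t. P t - \<phi> t) 1) \<le> \<eta> * exp (?L + 1 / 2)"
  proof (rule gronwall)
    fix t :: real assume t: "t \<in> {0..1}"
    have "(\<phi> has_vector_derivative X \<mu> (\<phi> t)) (at t within {0..1})"
      using sol t by (simp add: solution_iff)
    then show "((\<lambda>t. P t - \<phi> t) has_vector_derivative P' t - X \<mu> (\<phi> t)) (at t within {0..1})"
      by (intro has_vector_derivative_diff P t)
    have "2 * cmod \<mu> * t \<le> 2 * cmod \<mu>" using t by (simp add: mult_left_le)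
    then have "max_norm (\<phi> t - x) \<le> r" using solution_stays[OF sol \<mu> t] r by linarith
    then have "norm (X \<mu> (P t) - X \<mu> (\<phi> t)) \<le> ?L * norm (P t - \<phi> t)"
      using P(2)[OF t] r x \<mu> by (intro X_lipschitz) (auto intro!: complex_nbhdI[OF x])
    moreover have "norm (P' t - X \<mu> (\<phi> t)) \<le> norm (P' t - X \<mu> (P t)) + norm (X \<mu> (P t) - X \<mu> (\<phi> t))"
      using norm_triangle_ineq[of "P' t - X \<mu> (P t)" "X \<mu> (P t) - X \<mu> (\<phi> t)"] by simp
    ultimately show "norm (P' t - X \<mu> (\<phi> t)) \<le> ?L * norm (P t - \<phi> t) + \<eta>"
      using \<eta>[OF t] by linarith
  qed (use sol P \<eta>0 r \<mu>max_pos in \<open>auto simp: solution_iff\<close>)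
  then show ?thesis by simp
qed

lemma solution_unique:
  assumes x: "x \<in> D0" and \<mu>: "cmod \<mu> < \<mu>max" and sol: "solution \<mu> x \<phi>" "solution \<mu> x \<psi>"
  shows "\<psi> 1 = \<phi> 1"
proof -
  have "norm (\<psi> 1 - \<phi> 1) \<le> 0 * exp (real CARD('n) * 4 * \<mu>max / ((\<mu>max - cmod \<mu>) / 2) + 1 / 2)"
  proof (rule approximate_solution[OF x sol(1)])
    show "2 * cmod \<mu> < \<delta> / 3 - (\<mu>max - cmod \<mu>) / 2" using \<mu> \<mu>max_le by (simp add: field_simps)
    fix t :: real assume t: "t \<in> {0..1}"
    have "2 * cmod \<mu> * t \<le> 2 * cmod \<mu>" using t by (simp add: mult_left_le)
    then show "max_norm (\<psi> t - x) \<le> 2 * cmod \<mu>" using solution_stays[OF sol(2) _ t] \<mu> by linarith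
    show "(\<psi> has_vector_derivative X \<mu> (\<psi> t)) (at t within {0..1})"
      using sol(2) t by (simp add: solution_iff)
  qed (use sol(2) \<mu> in \<open>auto simp: solution_iff\<close>)
  then show ?thesis by simp
qed

lemma time_one_eq:
  assumes "x \<in> D0" "cmod \<mu> < \<mu>max" "solution \<mu> x \<phi>"
  shows "time_one \<mu> x = \<phi> 1"
  unfolding flow_def using assms solution_unique by (intro the_equality) blast+

lemma flow_defined:
  assumes "x \<in> D0" "cmod \<mu> < \<mu>max"
  shows "flow_defined_at (U (\<delta> / 3)) (X \<mu>) 1 x"
  unfolding flow_defined_at_def using solution_exists[OF assms] solution_unique[OF assms] by metis

lemma time_one_displacement:
  assumes "x \<in> D0" "cmod \<mu> < \<mu>max"
  shows "max_norm (time_one \<mu> x - x) \<le> 2 * cmod \<mu>"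
proof -
  obtain \<phi> where \<phi>: "solution \<mu> x \<phi>" using solution_exists[OF assms] .
  show ?thesis using solution_stays[OF \<phi>, of 1] time_one_eq[OF assms \<phi>] assms by simp
qed

section \<open>The time-one map is holomorphic in the parameter\<close>

primrec euler :: "nat \<Rightarrow> complex \<Rightarrow> complex ^ 'n \<Rightarrow> nat \<Rightarrow> complex ^ 'n" where
  "euler N \<mu> x 0 = x"
| "euler N \<mu> x (Suc j) = euler N \<mu> x j + (1 / real N) *\<^sub>R X \<mu> (euler N \<mu> x j)"

lemma euler_stays:
  assumes x: "x \<in> D0" and \<mu>: "cmod \<mu> < \<mu>max" and N: "0 < N"
  shows "j \<le> N \<Longrightarrow> max_norm (euler N \<mu> x j - x) \<le> 2 * cmod \<mu> * (real j / real N)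
    \<and> max_norm (euler N \<mu> x j - x) \<le> 2 * cmod \<mu> \<and> euler N \<mu> x j \<in> U (\<delta> / 3)"
proof (induction j)
  case 0
  then show ?case using x \<delta>_pos by (auto intro: complex_nbhdI)
next
  case (Suc j)
  have "euler N \<mu> x (Suc j) - x = (euler N \<mu> x j - x) + (1 / real N) *\<^sub>R X \<mu> (euler N \<mu> x j)" by simp
  then have "max_norm (euler N \<mu> x (Suc j) - x) \<le> max_norm (euler N \<mu> x j - x) + 1 / real N * max_norm (X \<mu> (euler N \<mu> x j))"
    using max_norm_triangle[of "euler N \<mu> x j - x" "(1 / real N) *\<^sub>R X \<mu> (euler N \<mu> x j)"]
    by (simp only: max_norm_scaleR) simp
  also have "\<dots> \<le> 2 * cmod \<mu> * (real j / real N) + 1 / real N * (2 * cmod \<mu>)"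
    using Suc \<mu> by (intro add_mono mult_left_mono X_bound) auto
  also have "\<dots> = 2 * cmod \<mu> * (real (Suc j) / real N)" by (simp add: field_simps add_divide_distrib)
  finally have 1: "max_norm (euler N \<mu> x (Suc j) - x) \<le> 2 * cmod \<mu> * (real (Suc j) / real N)" .
  also have "\<dots> \<le> 2 * cmod \<mu>"
    using Suc.prems N by (intro mult_left_le) (auto simp: field_simps)
  finally have 2: "max_norm (euler N \<mu> x (Suc j) - x) \<le> 2 * cmod \<mu>" .
  then have "euler N \<mu> x (Suc j) \<in> U (\<delta> / 3)" using \<mu> \<mu>max_le by (intro complex_nbhdI[OF x]) simp
  with 1 2 show ?case by blast
qed

text \<open>An Euler polygon is a finite composition of holomorphic maps, so its holomorphy in \<open>\<mu>\<close> follows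
  from the chain rule alone, whereas Picard iterates would involve integrals depending on \<open>\<mu>\<close>.\<close>

lemma curve_diff_at_euler:
  assumes x: "x \<in> D0" and \<mu>: "cmod \<mu> < \<mu>max" and N: "0 < N"
  shows "j \<le> N \<Longrightarrow> curve_diff_at (\<lambda>\<mu>. euler N \<mu> x j) \<mu>"
proof (induction j)
  case (Suc j)
  have "curve_diff_at (\<lambda>\<mu>. X \<mu> (euler N \<mu> x j)) \<mu>"
    using Suc euler_stays[OF assms, of j] \<mu> by (intro curve_diff_at_X) auto
  then show ?case unfolding euler.simps scaleR_eq_smult
    using Suc by (intro curve_diff_at_add curve_diff_at_smult field_differentiable_const) auto
qed (simp add: curve_diff_at_const)

lemma euler_converges:
  assumes x: "x \<in> D0" and r: "r < \<mu>max" and \<mu>: "cmod \<mu> \<le> r" and N: "0 < N"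
    and L: "L = real CARD('n) * 4 * \<mu>max / (\<mu>max - r)"
  shows "norm (euler N \<mu> x N - time_one \<mu> x) \<le> L * (real CARD('n) * (2 * \<mu>max)) * exp L / real N"
proof -
  have \<mu>': "cmod \<mu> < \<mu>max" using r \<mu> by simp
  obtain \<phi> where \<phi>: "solution \<mu> x \<phi>" using solution_exists[OF x \<mu>'] .
  define K where "K = {y. max_norm (y - x) \<le> 2 * cmod \<mu>}"
  have KU: "K \<subseteq> U (\<delta> / 3 - (\<mu>max - r))"
    using r \<mu> \<mu>max_le by (auto simp: K_def intro!: complex_nbhdI[OF x])
  have KU': "K \<subseteq> U (\<delta> / 3)"
    using KU complex_nbhd_mono[of "\<delta> / 3 - (\<mu>max - r)" "\<delta> / 3" D0] r by auto
  have "norm (euler N \<mu> x N - \<phi> 1) \<le> L * (real CARD('n) * (2 * \<mu>max)) * exp L / real N"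
  proof (rule euler_polygon_error[where K = K and V = "X \<mu>" and y = "euler N \<mu> x"])
    show "norm (X \<mu> y - X \<mu> z) \<le> L * norm (y - z)" if "y \<in> K" "z \<in> K" for y z
      unfolding L using that KU \<mu>' r by (intro X_lipschitz) auto
    show "0 \<le> L" using r \<mu>max_pos by (simp add: L)
    show "norm (X \<mu> y) \<le> real CARD('n) * (2 * \<mu>max)" if "y \<in> K" for y
    proof -
      have "max_norm (X \<mu> y) \<le> 2 * \<mu>max" using X_bound[of y \<mu>] that KU' \<mu>' by auto
      then have "real CARD('n) * max_norm (X \<mu> y) \<le> real CARD('n) * (2 * \<mu>max)"
        by (intro mult_left_mono) auto
      with norm_le_card_max_norm[of "X \<mu> y"] show ?thesis by linarith
    qed
    show "(\<phi> has_vector_derivative X \<mu> (\<phi> t)) (at t within {0..1})" if "t \<in> {0..1}" for t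
      using \<phi> that by (simp add: solution_iff)
    show "\<phi> t \<in> K" if t: "t \<in> {0..1}" for t
    proof -
      have "2 * cmod \<mu> * t \<le> 2 * cmod \<mu>" using t by (simp add: mult_left_le)
      then show ?thesis using solution_stays[OF \<phi> _ t] \<mu>' unfolding K_def by simp
    qed
    show "euler N \<mu> x j \<in> K" if "j \<le> N" for j
      using euler_stays[OF x \<mu>' N that] by (simp add: K_def)
  qed (use \<phi> N in \<open>auto simp: solution_iff\<close>)
  then show ?thesis using time_one_eq[OF x \<mu>' \<phi>] by simp
qed

lemma time_one_holomorphic:
  assumes x: "x \<in> D0"
  shows "(\<lambda>\<mu>. time_one \<mu> x $ i) holomorphic_on ball 0 \<mu>max"
proof (rule holomorphic_uniform_sequence[where f = "\<lambda>n \<mu>. euler (Suc n) \<mu> x (Suc n) $ i"])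
  show "(\<lambda>\<mu>. euler (Suc n) \<mu> x (Suc n) $ i) holomorphic_on ball 0 \<mu>max" for n
    using x by (intro curve_component_holomorphic curve_diff_at_euler) auto
  fix w :: complex assume "w \<in> ball 0 \<mu>max"
  then have w: "cmod w < \<mu>max" by simp
  define d where "d = (\<mu>max - cmod w) / 2"
  define r where "r = cmod w + d"
  define L where "L = real CARD('n) * 4 * \<mu>max / (\<mu>max - r)"
  define C where "C = L * (real CARD('n) * (2 * \<mu>max)) * exp L"
  have d: "0 < d" "r < \<mu>max" using w by (auto simp: d_def r_def field_simps)
  have le: "cmod \<mu> \<le> r" if "\<mu> \<in> cball w d" for \<mu>
    using that norm_triangle_ineq2[of \<mu> w] by (simp add: r_def dist_norm norm_minus_commute)
  have "uniform_limit (cball w d) (\<lambda>n \<mu>. euler (Suc n) \<mu> x (Suc n) $ i) (\<lambda>\<mu>. time_one \<mu> x $ i) sequentially"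
  proof (rule uniform_limitI)
    fix e :: real assume e: "0 < e"
    have "(\<lambda>n. C / real (Suc n)) \<longlonglongrightarrow> 0"
      by (rule LIMSEQ_Suc[OF lim_const_over_n])
    then have "\<forall>\<^sub>F n in sequentially. C / real (Suc n) < e"
      using e by (rule order_tendstoD(2))
    then show "\<forall>\<^sub>F n in sequentially. \<forall>\<mu>\<in>cball w d. dist (euler (Suc n) \<mu> x (Suc n) $ i) (time_one \<mu> x $ i) < e"
    proof eventually_elim
      case (elim n)
      show ?case
      proof
        fix \<mu> assume "\<mu> \<in> cball w d"
        from euler_converges[OF x d(2) le[OF this] _ L_def, of "Suc n"]
        have "norm (euler (Suc n) \<mu> x (Suc n) - time_one \<mu> x) < e" using elim by (simp add: C_def)
        then have "norm ((euler (Suc n) \<mu> x (Suc n) - time_one \<mu> x) $ i) < e"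
          by (rule le_less_trans[OF Finite_Cartesian_Product.norm_nth_le])
        then show "dist (euler (Suc n) \<mu> x (Suc n) $ i) (time_one \<mu> x $ i) < e"
          by (simp add: dist_norm)
      qed
    qed
  qed
  then show "\<exists>d. 0 < d \<and> cball w d \<subseteq> ball 0 \<mu>max \<and>
      uniform_limit (cball w d) (\<lambda>n \<mu>. euler (Suc n) \<mu> x (Suc n) $ i) (\<lambda>\<mu>. time_one \<mu> x $ i) sequentially"
    using d le by (intro exI[of _ d]) force
qed auto

end

section \<open>Generalised binomial coefficients as functions of the upper argument\<close>

text \<open>As a function of \<open>z\<close>, \<open>z gchoose k\<close> is the Newton basis polynomial for the nodes
  \<open>0, 1, 2, \<dots>\<close>; interpolation in complex time requires its size and its derivative.\<close>

lemma norm_gbinomial_le: "cmod (z gchoose k) \<le> (cmod z + real k) ^ k"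
proof -
  have "cmod (z gchoose k) = (\<Prod>i<k. cmod (z - of_nat i)) / fact k"
    by (simp add: gbinomial_prod_rev norm_divide prod_norm atLeast0LessThan)
  also have "\<dots> \<le> (\<Prod>i<k. cmod (z - of_nat i)) / 1"
    by (intro divide_left_mono prod_nonneg) (auto simp: fact_ge_1)
  also have "\<dots> \<le> (\<Prod>i<k. cmod z + real k)"
  proof -
    have "cmod (z - of_nat i) \<le> cmod z + real k" if "i < k" for i
      using norm_triangle_ineq4[of z "of_nat i"] that by simp
    then show ?thesis by (simp del: prod_constant) (intro prod_mono, auto)
  qed
  finally show ?thesis by simp
qed

lemma gbinomial_holomorphic: "(\<lambda>z::complex. z gchoose k) holomorphic_on S"
  unfolding gbinomial_prod_rev by (intro holomorphic_intros) auto

lemma gbinomial_field_differentiable: "(\<lambda>z::complex. z gchoose k) field_differentiable (at z)"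
  using gbinomial_holomorphic[of k UNIV] by (simp add: holomorphic_on_def)

text \<open>The coefficients of the interpolating vector field are the derivatives at time 0 of the Newton
  basis polynomials.\<close>

lemma gbinomial_deriv_0:
  "((\<lambda>s::complex. s gchoose j) has_field_derivative (if j = 0 then 0 else (- 1) ^ (j - 1) / of_nat j)) (at 0)"
proof (cases j)
  case (Suc i)
  obtain d where d: "((\<lambda>s::complex. s gchoose i) has_field_derivative d) (at (0 - 1))"
    using gbinomial_field_differentiable field_differentiable_def by blast
  have "((\<lambda>s::complex. s - 1 gchoose i) has_field_derivative d * 1) (at 0)"
    by (rule DERIV_chain2[where g = "\<lambda>s. s - 1", OF d]) (auto intro!: derivative_eq_intros)
  then have "((\<lambda>s::complex. s / of_nat j * (s - 1 gchoose i)) has_field_derivative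
      (1 / of_nat j * (0 - 1 gchoose i) + d * 1 * (0 / of_nat j))) (at 0)"
    by (intro DERIV_mult DERIV_cdivide DERIV_ident)
  moreover have "(\<lambda>s::complex. s / of_nat j * (s - 1 gchoose i)) = (\<lambda>s. s gchoose j)"
    using Suc by (auto simp: gbinomial_absorption' fun_eq_iff)
  moreover have "(- 1 gchoose i) = ((- 1) ^ i :: complex)"
    using gbinomial_minus[of "1::complex" i] binomial_gbinomial[of i i, where ?'a = complex] by simp
  ultimately show ?thesis using Suc by simp
qed simp

text \<open>Differentiate the Vandermonde identity for \<open>s + z gchoose l\<close> at \<open>s = 0\<close>.\<close>

lemma gbinomial_deriv:
  "((\<lambda>z::complex. z gchoose l) has_field_derivative
    (\<Sum>k<l. (z gchoose k) * ((- 1) ^ (l - k - 1) / of_nat (l - k)))) (at z)"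
proof -
  have "((\<lambda>s. \<Sum>k=0..l. (z gchoose k) * (s gchoose (l - k))) has_field_derivative
      (\<Sum>k=0..l. (z gchoose k) * (if l - k = 0 then 0 else (- 1) ^ (l - k - 1) / of_nat (l - k)))) (at 0)"
    by (intro DERIV_sum DERIV_cmult gbinomial_deriv_0)
  moreover have "(\<lambda>s. \<Sum>k=0..l. (z gchoose k) * (s gchoose (l - k))) = (\<lambda>s. s + z gchoose l)"
    by (simp add: gbinomial_Vandermonde add.commute)
  moreover have "(\<Sum>k=0..l. (z gchoose k) * (if l - k = 0 then 0 else (- 1) ^ (l - k - 1) / of_nat (l - k))) =
      (\<Sum>k<l. (z gchoose k) * ((- 1) ^ (l - k - 1) / of_nat (l - k)))"
    by (intro sum.mono_neutral_cong_right) auto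
  ultimately show ?thesis using DERIV_shift[of "\<lambda>z. z gchoose l" _ 0 z] by simp
qed

text \<open>Summing up to the fixed degree \<open>m\<close> changes nothing at a node \<open>n \<le> m\<close>, since \<open>n choose k = 0\<close> for
  \<open>k > n\<close>.\<close>

lemma newton_at_node:
  assumes "n \<le> m"
  shows "(\<Sum>k\<le>m. (complex_of_nat n gchoose k) *s fin_diff f (j + k) x) = fin_diff f j ((f ^^ n) x)"
proof -
  have "(\<Sum>k\<le>m. (complex_of_nat n gchoose k) *s fin_diff f (j + k) x) =
      (\<Sum>k\<le>m. real (n choose k) *\<^sub>R fin_diff f (j + k) x)"
    by (simp add: binomial_gbinomial scaleR_eq_smult flip: of_nat_gbinomial)
  also have "\<dots> = (\<Sum>k\<le>n. real (n choose k) *\<^sub>R fin_diff f (j + k) x)"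
    using assms by (intro sum.mono_neutral_right) (auto simp: binomial_eq_0)
  finally show ?thesis by (simp add: fin_diff_iterate)
qed

section \<open>Order of contact of the flow with the map\<close>

context interpolation
begin

text \<open>Orders up to \<open>2 m\<close> occur because the field is itself a combination of differences up to order
  \<open>m\<close>, of which differences up to order \<open>m\<close> are taken again.\<close>

lemma fin_diff_order:
  obtains A s where "1 \<le> A" "0 < s"
    "\<And>\<mu> y k. cmod \<mu> \<le> s \<Longrightarrow> y \<in> U (\<delta> / 3) \<Longrightarrow> 1 \<le> k \<Longrightarrow> k \<le> 2 * m \<Longrightarrow>
      max_norm (fin_diff (F \<mu>) k y) \<le> A * cmod \<mu> ^ k"
proof -
  define \<rho> where "\<rho> = \<delta> / (6 * real m)"
  define A where "A = max 1 (2 / \<rho>) ^ (2 * m)"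
  have \<rho>: "0 < \<rho>" using \<delta>_pos m_ge_2 by (simp add: \<rho>_def)
  have "max_norm (fin_diff (F \<mu>) k y) \<le> A * cmod \<mu> ^ k"
    if \<mu>: "cmod \<mu> \<le> \<rho>" and y: "y \<in> U (\<delta> / 3)" and k: "1 \<le> k" "k \<le> 2 * m" for \<mu> y k
  proof -
    obtain i where i: "k = Suc i" using k by (cases k) auto
    have "real i * \<rho> \<le> real (2 * m) * \<rho>" using i k \<rho> by (intro mult_right_mono) auto
    also have "\<dots> = \<delta> / 3" using m_ge_2 by (simp add: \<rho>_def)
    finally have "\<delta> / 3 \<le> \<delta> - real i * \<rho>" using \<delta>_pos by simp
    then have "y \<in> U (\<delta> - real i * \<rho>)" using y complex_nbhd_mono by blast
    then have "max_norm (fin_diff (F \<mu>) (Suc i) y) \<le> cmod \<mu> * (2 * cmod \<mu> / \<rho>) ^ i"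
      by (rule fin_diff_bound[OF \<rho> \<mu>])
    also have "\<dots> = (2 / \<rho>) ^ i * cmod \<mu> ^ k" by (simp add: i power_mult_distrib power_divide)
    also have "\<dots> \<le> A * cmod \<mu> ^ k"
    proof (rule mult_right_mono)
      have "(2 / \<rho>) ^ i \<le> max 1 (2 / \<rho>) ^ i" using \<rho> by (intro power_mono) auto
      also have "\<dots> \<le> A" unfolding A_def using i k by (intro power_increasing) auto
      finally show "(2 / \<rho>) ^ i \<le> A" .
    qed simp
    finally show ?thesis by (simp add: i)
  qed
  moreover have "1 \<le> A" unfolding A_def by (intro one_le_power) auto
  ultimately show ?thesis using that \<rho> by blast
qed

text \<open>The Newton interpolation polynomial in time of the orbit of \<open>x\<close> at the nodes \<open>0, \<dots>, m\<close>.\<close>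

definition newton_path :: "complex \<Rightarrow> complex ^ 'n \<Rightarrow> complex \<Rightarrow> complex ^ 'n" where
  "newton_path \<mu> x z = (\<Sum>k\<le>m. (z gchoose k) *s fin_diff (F \<mu>) k x)"

text \<open>The Newton interpolation polynomial of the same degree of the field along the orbit of \<open>x\<close>; the
  differences of \<open>X \<mu>\<close> are expressed by those of the identity map.\<close>

definition newton_field :: "complex \<Rightarrow> complex ^ 'n \<Rightarrow> complex \<Rightarrow> complex ^ 'n" where
  "newton_field \<mu> x z = (\<Sum>k\<le>m. (z gchoose k) *s
     (\<Sum>j=1..m. ((-1) ^ (j - 1) / real j) *\<^sub>R fin_diff (F \<mu>) (j + k) x))"

lemma newton_path_at_node: "n \<le> m \<Longrightarrow> newton_path \<mu> x (of_nat n) = (F \<mu> ^^ n) x"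
  using newton_at_node[of n m "F \<mu>" 0 x] by (simp add: newton_path_def)

lemma newton_field_at_node:
  assumes "n \<le> m"
  shows "newton_field \<mu> x (of_nat n) = X \<mu> ((F \<mu> ^^ n) x)"
proof -
  have "newton_field \<mu> x (of_nat n) = (\<Sum>j=1..m. ((-1) ^ (j - 1) / real j) *\<^sub>R
      (\<Sum>k\<le>m. (of_nat n gchoose k) *s fin_diff (F \<mu>) (j + k) x))"
    unfolding newton_field_def scaleR_eq_smult vec.scale_sum_right
    by (subst sum.swap) (simp add: vector_smult_assoc mult.commute)
  then show ?thesis by (simp add: newton_at_node[OF assms] interp_field_def)
qed

lemma curve_diff_at_newton_path: "curve_diff_at (newton_path \<mu> x) z"
  unfolding newton_path_def[abs_def]
  by (intro curve_diff_at_sum curve_diff_at_smult gbinomial_field_differentiable curve_diff_at_const)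

lemma curve_diff_at_newton_field: "curve_diff_at (newton_field \<mu> x) z"
  unfolding newton_field_def[abs_def]
  by (intro curve_diff_at_sum curve_diff_at_smult gbinomial_field_differentiable curve_diff_at_const)

definition newton_velocity :: "complex \<Rightarrow> complex ^ 'n \<Rightarrow> complex \<Rightarrow> complex ^ 'n" where
  "newton_velocity \<mu> x z = (\<Sum>l\<le>m. (\<Sum>k<l. (z gchoose k) * ((- 1) ^ (l - k - 1) / of_nat (l - k))) *s fin_diff (F \<mu>) l x)"

lemma newton_path_has_velocity:
  "((\<lambda>t. newton_path \<mu> x (complex_of_real t)) has_vector_derivative newton_velocity \<mu> x (of_real t)) (at t within S)"
  unfolding newton_path_def newton_velocity_def
  by (intro has_vector_derivative_sum
      bounded_linear.has_vector_derivative[OF bounded_bilinear.bounded_linear_left[OF bounded_bilinear_smult]]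
      has_vector_derivative_real_field gbinomial_deriv)

text \<open>Both sides of the equation of motion are combinations of the products \<open>(z gchoose k) \<Delta>_(j+k)\<close> with
  the same coefficients; the velocity contains only those with \<open>j + k \<le> m\<close>. The remaining ones have
  order at least \<open>m + 1\<close> in \<open>\<mu>\<close>.\<close>

lemma newton_field_minus_velocity:
  "newton_field \<mu> x z - newton_velocity \<mu> x z =
    (\<Sum>(k, j) \<in> {(k, j). k \<le> m \<and> 1 \<le> j \<and> j \<le> m \<and> m < k + j}.
      ((z gchoose k) * ((-1) ^ (j - 1) / of_nat j)) *s fin_diff (F \<mu>) (j + k) x)"
proof -
  define T where "T = (\<lambda>(k, j). ((z gchoose k) * ((-1) ^ (j - 1) / of_nat j)) *s fin_diff (F \<mu>) (j + k) x)"
  define hi where "hi = {(k, j). k \<le> m \<and> 1 \<le> j \<and> j \<le> m \<and> m < k + j}"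
  define lo where "lo = {(k, j). 1 \<le> j \<and> k + j \<le> m}"
  have "finite ({..m} \<times> {1..m})" by simp
  then have fin: "finite hi" "finite lo"
    by (rule finite_subset[rotated], force simp: hi_def lo_def)+
  have "newton_field \<mu> x z = (\<Sum>k\<le>m. \<Sum>j=1..m. T (k, j))"
    unfolding newton_field_def scaleR_eq_smult vec.scale_sum_right T_def
    by (intro sum.cong refl) (simp add: vector_smult_assoc)
  also have "\<dots> = (\<Sum>p\<in>{..m} \<times> {1..m}. T p)" by (simp add: sum.cartesian_product)
  also have "{..m} \<times> {1..m} = hi \<union> lo" by (auto simp: hi_def lo_def)
  also have "(\<Sum>p\<in>hi \<union> lo. T p) = (\<Sum>p\<in>hi. T p) + (\<Sum>p\<in>lo. T p)"
    using fin by (intro sum.union_disjoint) (auto simp: hi_def lo_def)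
  also have "(\<Sum>p\<in>lo. T p) = (\<Sum>(l, k)\<in>(SIGMA l:{..m}. {..<l}). T (k, l - k))"
    by (rule sum.reindex_bij_witness[of _ "\<lambda>(l, k). (k, l - k)" "\<lambda>(k, j). (k + j, k)"]) (auto simp: lo_def)
  also have "\<dots> = newton_velocity \<mu> x z"
    unfolding newton_velocity_def vec.scale_sum_left by (subst sum.Sigma[symmetric]) (auto simp: T_def)
  finally show ?thesis by (simp add: T_def hi_def)
qed

text \<open>The coefficient of \<open>z gchoose k\<close> in the path is \<open>O(|\<mu>| ^ k)\<close>, so the path stays near \<open>x\<close> for complex
  times up to \<open>R = c / |\<mu>|\<close>. On that large disc the difference between the field along the path and its
  interpolation polynomial is holomorphic and bounded uniformly in \<open>\<mu>\<close>, and it vanishes at the \<open>m + 1\<close>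
  nodes. The Schwarz lemma makes it \<open>O(R ^ - (m + 1))\<close> on the unit interval. Together with
  \<open>newton_field_minus_velocity\<close>, the path is a solution of the equation up to \<open>O(|\<mu>| ^ (m + 1))\<close>.\<close>

lemma time_one_order_of_contact:
  assumes x: "x \<in> D0"
  obtains C s where "0 < s"
    "\<And>\<mu>. \<mu> \<noteq> 0 \<Longrightarrow> cmod \<mu> < s \<Longrightarrow> norm (F \<mu> x - time_one \<mu> x) \<le> C * cmod \<mu> ^ Suc m"
proof -
  obtain A s0 where A: "1 \<le> A" and s0: "0 < s0" and fd: "\<And>\<mu> y k. cmod \<mu> \<le> s0 \<Longrightarrow> y \<in> U (\<delta> / 3) \<Longrightarrow>
      1 \<le> k \<Longrightarrow> k \<le> 2 * m \<Longrightarrow> max_norm (fin_diff (F \<mu>) k y) \<le> A * cmod \<mu> ^ k"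
    by (rule fin_diff_order) blast
  \<comment> \<open>The constant \<open>c\<close> keeps the path within \<open>\<delta> / 6\<close> of \<open>x\<close>; the last entry of \<open>s\<close> makes \<open>R\<close> at least
    twice as large as every node, so that \<open>R - n \<ge> R / 2\<close>.\<close>
  define c where "c = min (1 / 2) (\<delta> / (12 * real m * A))"
  have c: "0 < c" "2 * c \<le> 1" "2 * c * real m * A \<le> \<delta> / 6"
  proof -
    have "0 < real m" using m_ge_2 by simp
    then have "0 < real m * A" using A by (intro mult_pos_pos) auto
    then show "0 < c" using \<delta>_pos by (simp add: c_def mult.assoc)
    have "c * (real m * A) \<le> \<delta> / (12 * real m * A) * (real m * A)"
      using \<open>0 < real m * A\<close> by (intro mult_right_mono) (auto simp: c_def)
    also have "\<dots> = \<delta> / 12" using A m_ge_2 by simp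
    finally show "2 * c * real m * A \<le> \<delta> / 6" by simp
  qed (simp add: c_def)
  define s where "s = min (min s0 1) (min (\<mu>max / 2) (c / (2 * (real m + 1))))"
  have s: "0 < s" using s0 \<mu>max_pos c by (simp add: s_def)
  \<comment> \<open>\<open>B\<close> bounds the interpolation defect on the disc of radius \<open>R\<close>; \<open>C1\<close> and \<open>C2\<close> are the implied
    constants of the interpolation error and of the truncation of the velocity.\<close>
  define B where "B = 2 + real (m + 1) * (real m * A)"
  define C1 where "C1 = B * (2 * (real m + 1) / c) ^ Suc m"
  define C2 where "C2 = real ((m + 1) * m) * ((1 + real m) ^ m * A)"
  define C where "C = real CARD('n) * (C1 + C2) * exp (real CARD('n) * 4 * \<mu>max / (\<delta> / 12) + 1 / 2)"
  have "norm (F \<mu> x - time_one \<mu> x) \<le> C * cmod \<mu> ^ Suc m" if \<mu>0: "\<mu> \<noteq> 0" and \<mu>s: "cmod \<mu> < s" for \<mu>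
  proof -
    have \<mu>: "0 < cmod \<mu>" "cmod \<mu> \<le> s0" "cmod \<mu> \<le> 1" "2 * cmod \<mu> \<le> \<mu>max" "cmod \<mu> < c / (2 * (real m + 1))"
      using \<mu>0 \<mu>s by (auto simp: s_def)
    have \<mu>': "cmod \<mu> < \<mu>max" using \<mu> \<mu>max_pos by simp
    have xU: "x \<in> U (\<delta> / 3)" using \<delta>_pos x by (auto intro: complex_nbhdI)
    define R where "R = c / cmod \<mu>"
    have R: "2 * (real m + 1) < R" using \<mu> by (simp add: R_def field_simps)
    have gb: "cmod (z gchoose k) * cmod \<mu> ^ k \<le> (2 * c) ^ k" if "cmod z < R" "k \<le> m" for z k
    proof -
      have "cmod (z gchoose k) \<le> (2 * R) ^ k"
        using norm_gbinomial_le[of z k] that R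
        by (elim order_trans) (intro power_mono, auto)
      then have "cmod (z gchoose k) * cmod \<mu> ^ k \<le> (2 * R) ^ k * cmod \<mu> ^ k"
        by (intro mult_right_mono) auto
      also have "\<dots> = (2 * R * cmod \<mu>) ^ k" by (simp only: power_mult_distrib)
      also have "2 * R * cmod \<mu> = 2 * c" using \<mu>(1) by (simp add: R_def)
      finally show ?thesis .
    qed
    have path: "max_norm (newton_path \<mu> x z - x) \<le> \<delta> / 6" if z: "cmod z < R" for z
    proof -
      have "newton_path \<mu> x z - x = (\<Sum>k=1..m. (z gchoose k) *s fin_diff (F \<mu>) k x)"
        by (simp add: newton_path_def atMost_atLeast0 sum.atLeast_Suc_atMost[of 0 m])
      also have "max_norm \<dots> \<le> (\<Sum>k=1..m. max_norm ((z gchoose k) *s fin_diff (F \<mu>) k x))"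
        by (rule max_norm_sum)
      also have "\<dots> \<le> (\<Sum>k=1..m. 2 * c * A)"
      proof (rule sum_mono)
        fix k assume k: "k \<in> {1..m}"
        have "max_norm ((z gchoose k) *s fin_diff (F \<mu>) k x) \<le> cmod (z gchoose k) * (A * cmod \<mu> ^ k)"
          unfolding max_norm_smult using k \<mu> xU by (intro mult_left_mono fd) auto
        also have "\<dots> = (cmod (z gchoose k) * cmod \<mu> ^ k) * A" by simp
        also have "\<dots> \<le> (2 * c) ^ k * A" using gb[OF z] k A by (intro mult_right_mono) auto
        also have "\<dots> \<le> (2 * c) ^ 1 * A" using c k A by (intro mult_right_mono power_decreasing) auto
        finally show "max_norm ((z gchoose k) *s fin_diff (F \<mu>) k x) \<le> 2 * c * A" by simp
      qed
      also have "\<dots> \<le> \<delta> / 6" using c(3) by (simp add: mult_ac)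
      finally show ?thesis .
    qed
    have pathU: "newton_path \<mu> x z \<in> U (\<delta> / 3)" if "cmod z < R" for z
      using path[OF that] \<delta>_pos by (intro complex_nbhdI[OF x]) linarith
    have field: "max_norm (newton_field \<mu> x z) \<le> real (m + 1) * (real m * A)" if z: "cmod z < R" for z
    proof -
      have "max_norm (newton_field \<mu> x z) \<le> (\<Sum>k\<le>m. max_norm ((z gchoose k) *s
          (\<Sum>j=1..m. ((-1) ^ (j - 1) / real j) *\<^sub>R fin_diff (F \<mu>) (j + k) x)))"
        unfolding newton_field_def by (rule max_norm_sum)
      also have "\<dots> \<le> (\<Sum>k\<le>m. real m * A)"
      proof (rule sum_mono)
        fix k assume k: "k \<in> {..m}"
        have "max_norm (\<Sum>j=1..m. ((-1) ^ (j - 1) / real j) *\<^sub>R fin_diff (F \<mu>) (j + k) x) \<le>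
            (\<Sum>j=1..m. max_norm (((-1) ^ (j - 1) / real j) *\<^sub>R fin_diff (F \<mu>) (j + k) x))"
          by (rule max_norm_sum)
        also have "\<dots> \<le> (\<Sum>j=1..m. A * cmod \<mu> ^ k)"
        proof (rule sum_mono)
          fix j assume j: "j \<in> {1..m}"
          have "max_norm (((-1) ^ (j - 1) / real j) *\<^sub>R fin_diff (F \<mu>) (j + k) x) =
              max_norm (fin_diff (F \<mu>) (j + k) x) / real j"
            by (simp add: max_norm_scaleR power_abs)
          also have "\<dots> \<le> max_norm (fin_diff (F \<mu>) (j + k) x) / 1"
            using j max_norm_nonneg by (intro divide_left_mono) auto
          also have "\<dots> \<le> A * cmod \<mu> ^ (j + k)" using fd[OF \<mu>(2) xU, of "j + k"] j k by simp
          also have "\<dots> \<le> A * cmod \<mu> ^ k" using \<mu> A by (intro mult_left_mono power_decreasing) auto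
          finally show "max_norm (((-1) ^ (j - 1) / real j) *\<^sub>R fin_diff (F \<mu>) (j + k) x) \<le> A * cmod \<mu> ^ k" .
        qed
        finally have "max_norm ((z gchoose k) *s (\<Sum>j=1..m. ((-1) ^ (j - 1) / real j) *\<^sub>R fin_diff (F \<mu>) (j + k) x))
            \<le> cmod (z gchoose k) * (real m * (A * cmod \<mu> ^ k))"
          unfolding max_norm_smult by (intro mult_left_mono) auto
        also have "\<dots> = (cmod (z gchoose k) * cmod \<mu> ^ k) * (real m * A)" by simp
        also have "\<dots> \<le> (2 * c) ^ k * (real m * A)" using gb[OF z] k A by (intro mult_right_mono) auto
        also have "\<dots> \<le> 1 * (real m * A)" using c A by (intro mult_right_mono power_le_one) auto
        finally show "max_norm ((z gchoose k) *s (\<Sum>j=1..m. ((-1) ^ (j - 1) / real j) *\<^sub>R fin_diff (F \<mu>) (j + k) x))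
            \<le> real m * A" by simp
      qed
      finally show ?thesis by simp
    qed
    have defect: "max_norm (X \<mu> (newton_path \<mu> x (of_real t)) - newton_field \<mu> x (of_real t)) \<le> C1 * cmod \<mu> ^ Suc m"
      if t: "t \<in> {0..1}" for t :: real
      unfolding max_norm_le_iff
    proof
      fix i
      define q where "q z = (X \<mu> (newton_path \<mu> x z) - newton_field \<mu> x z) $ i" for z
      have "cmod (q (of_real t)) \<le> B * (\<Prod>a\<in>of_nat ` {..m}. cmod (of_real t - a) / (R - cmod a))"
      proof (rule schwarz_lemma_nodes)
        show "q holomorphic_on ball 0 R" unfolding q_def
          using pathU \<mu>' by (intro curve_component_holomorphic curve_diff_at_diff curve_diff_at_newton_field
              curve_diff_at_compose[of "X \<mu>"] curve_diff_at_newton_path cdiff_at_X) auto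
        show "cmod (q z) \<le> B" if "z \<in> ball 0 R" for z
        proof -
          have z: "cmod z < R" using that by simp
          have "max_norm (X \<mu> (newton_path \<mu> x z) - newton_field \<mu> x z) \<le> B"
            using max_norm_diff_triangle[of "X \<mu> (newton_path \<mu> x z)" "newton_field \<mu> x z"]
              X_bound[OF pathU[OF z], of \<mu>] field[OF z] \<mu> \<mu>' unfolding B_def by linarith
          then show ?thesis by (simp add: q_def max_norm_le_iff)
        qed
        show "q a = 0" if "a \<in> of_nat ` {..m}" for a
          using that by (auto simp: q_def newton_path_at_node newton_field_at_node)
      qed (use R t in auto)
      also have "(\<Prod>a\<in>of_nat ` {..m}. cmod (of_real t - a) / (R - cmod a)) =
          (\<Prod>n\<le>m. cmod (of_real t - of_nat n) / (R - real n))"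
        by (subst prod.reindex) (auto simp: inj_on_def)
      also have "B * \<dots> \<le> B * (\<Prod>n\<le>m. (real m + 1) / (R / 2))"
      proof (intro mult_left_mono prod_mono conjI)
        fix n assume n: "n \<in> {..m}"
        have "cmod (of_real t - of_nat n) \<le> real m + 1"
          using norm_triangle_ineq4[of "of_real t" "of_nat n :: complex"] t n by simp
        then show "cmod (of_real t - of_nat n) / (R - real n) \<le> (real m + 1) / (R / 2)"
          using R n by (intro frac_le) auto
        show "0 \<le> cmod (of_real t - of_nat n) / (R - real n)" using R n by auto
      qed (use A in \<open>auto simp: B_def\<close>)
      also have "(real m + 1) / (R / 2) = 2 * (real m + 1) / c * cmod \<mu>"
        using \<mu>(1) c by (simp add: R_def)
      also have "B * (\<Prod>n\<le>m. 2 * (real m + 1) / c * cmod \<mu>) = C1 * cmod \<mu> ^ Suc m"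
        by (simp only: C1_def prod_constant card_atMost power_mult_distrib mult.assoc)
      finally show "cmod ((X \<mu> (newton_path \<mu> x (of_real t)) - newton_field \<mu> x (of_real t)) $ i) \<le> C1 * cmod \<mu> ^ Suc m"
        by (simp add: q_def)
    qed
    have velocity: "max_norm (newton_field \<mu> x (of_real t) - newton_velocity \<mu> x (of_real t)) \<le> C2 * cmod \<mu> ^ Suc m"
      if t: "t \<in> {0..1}" for t :: real
    proof -
      let ?hi = "{(k, j). k \<le> m \<and> 1 \<le> j \<and> j \<le> m \<and> m < k + j}"
      let ?T = "\<lambda>(k, j). ((of_real t gchoose k) * ((-1) ^ (j - 1) / of_nat j)) *s fin_diff (F \<mu>) (j + k) x"
      let ?b = "(1 + real m) ^ m * (A * cmod \<mu> ^ Suc m)"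
      have b0: "0 \<le> ?b" using A by simp
      have "max_norm (sum ?T ?hi) \<le> (\<Sum>p\<in>?hi. max_norm (?T p))" by (rule max_norm_sum)
      also have "\<dots> \<le> (\<Sum>p\<in>?hi. ?b)"
      proof (intro sum_mono, clarify)
        fix k j assume kj: "k \<le> m" "1 \<le> j" "j \<le> m" "m < k + j"
        have "cmod (of_real t gchoose k) \<le> (1 + real m) ^ k"
          using t kj norm_gbinomial_le[of "of_real t" k] by (elim order_trans) (intro power_mono, auto)
        also have "\<dots> \<le> (1 + real m) ^ m" using kj by (intro power_increasing) auto
        finally have 1: "cmod (of_real t gchoose k) \<le> (1 + real m) ^ m" .
        have 2: "max_norm (fin_diff (F \<mu>) (j + k) x) \<le> A * cmod \<mu> ^ Suc m"
        proof -
          have "max_norm (fin_diff (F \<mu>) (j + k) x) \<le> A * cmod \<mu> ^ (j + k)"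
            using kj by (intro fd[OF \<mu>(2) xU]) auto
          also have "\<dots> \<le> A * cmod \<mu> ^ Suc m"
            using kj \<mu> A by (intro mult_left_mono power_decreasing) auto
          finally show ?thesis .
        qed
        have "cmod ((of_real t gchoose k) * ((-1) ^ (j - 1) / of_nat j)) = cmod (of_real t gchoose k) / real j"
          by (simp add: norm_mult norm_divide norm_power)
        also have "\<dots> \<le> cmod (of_real t gchoose k) / 1" using kj by (intro divide_left_mono) auto
        finally have "cmod ((of_real t gchoose k) * ((-1) ^ (j - 1) / of_nat j)) \<le> (1 + real m) ^ m" using 1 by simp
        then show "max_norm (((of_real t gchoose k) * ((-1) ^ (j - 1) / of_nat j)) *s fin_diff (F \<mu>) (j + k) x) \<le> ?b"
          unfolding max_norm_smult using 2 by (intro mult_mono max_norm_nonneg) auto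
      qed
      also have "\<dots> = real (card ?hi) * ?b" by simp
      also have "\<dots> \<le> real ((m + 1) * m) * ?b"
      proof (intro mult_right_mono b0)
        have "card ?hi \<le> card ({..m} \<times> {1..m})" by (intro card_mono) auto
        then show "real (card ?hi) \<le> real ((m + 1) * m)" by (simp only: of_nat_le_iff) simp
      qed
      finally show ?thesis unfolding newton_field_minus_velocity by (simp add: C2_def mult_ac)
    qed
    obtain \<phi> where \<phi>: "solution \<mu> x \<phi>" using solution_exists[OF x \<mu>'] .
    have "norm (newton_path \<mu> x (of_real 1) - \<phi> 1) \<le> (real CARD('n) * ((C1 + C2) * cmod \<mu> ^ Suc m)) *
        exp (real CARD('n) * 4 * \<mu>max / (\<delta> / 12) + 1 / 2)"
    proof (rule approximate_solution[OF x \<phi>, where r = "\<delta> / 6" and P = "\<lambda>t. newton_path \<mu> x (of_real t)"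
          and P' = "\<lambda>t. newton_velocity \<mu> x (of_real t)"])
      show "2 * cmod \<mu> \<le> \<delta> / 6" using \<mu> \<mu>max_le by simp
      show "newton_path \<mu> x (of_real 0) = x" using newton_path_at_node[of 0 \<mu> x] by simp
      fix t :: real assume t: "t \<in> {0..1}"
      show "max_norm (newton_path \<mu> x (of_real t) - x) \<le> \<delta> / 6" using t R by (intro path) auto
      show "((\<lambda>t. newton_path \<mu> x (of_real t)) has_vector_derivative newton_velocity \<mu> x (of_real t)) (at t within {0..1})"
        by (rule newton_path_has_velocity)
      have "max_norm (newton_velocity \<mu> x (of_real t) - X \<mu> (newton_path \<mu> x (of_real t))) \<le> (C1 + C2) * cmod \<mu> ^ Suc m"
        using max_norm_triangle[of "X \<mu> (newton_path \<mu> x (of_real t)) - newton_field \<mu> x (of_real t)"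
            "newton_field \<mu> x (of_real t) - newton_velocity \<mu> x (of_real t)"] defect[OF t] velocity[OF t]
        by (simp add: max_norm_diff_commute distrib_right del: power_Suc)
      then have "real CARD('n) * max_norm (newton_velocity \<mu> x (of_real t) - X \<mu> (newton_path \<mu> x (of_real t)))
          \<le> real CARD('n) * ((C1 + C2) * cmod \<mu> ^ Suc m)"
        by (intro mult_left_mono) auto
      with norm_le_card_max_norm show "norm (newton_velocity \<mu> x (of_real t) - X \<mu> (newton_path \<mu> x (of_real t)))
          \<le> real CARD('n) * ((C1 + C2) * cmod \<mu> ^ Suc m)" by (rule order_trans)
    qed (use \<mu>' \<delta>_pos in auto)
    then show ?thesis
      using newton_path_at_node[of 1 \<mu> x] m_ge_2 time_one_eq[OF x \<mu>' \<phi>] by (simp add: C_def mult_ac)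
  qed
  then show ?thesis using that s by blast
qed

lemma time_one_error:
  assumes x: "x \<in> D0" and \<mu>: "cmod \<mu> < \<mu>max"
  shows "max_norm (time_one \<mu> x - F \<mu> x) \<le> 3 * \<mu>max * (cmod \<mu> / \<mu>max) ^ Suc m"
  unfolding max_norm_le_iff
proof
  fix i
  obtain C s where s: "0 < s" and C: "\<And>\<mu>. \<mu> \<noteq> 0 \<Longrightarrow> cmod \<mu> < s \<Longrightarrow> norm (F \<mu> x - time_one \<mu> x) \<le> C * cmod \<mu> ^ Suc m"
    using time_one_order_of_contact[OF x] by blast
  have x\<delta>: "x \<in> U \<delta>" using x \<delta>_pos by (auto intro: complex_nbhdI)
  have "cmod (time_one \<mu> x $ i - F \<mu> x $ i) \<le> 3 * \<mu>max * (cmod \<mu> / \<mu>max) ^ Suc m"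
  proof (rule schwarz_lemma_order[where s = s and C = C])
    show "(\<lambda>\<mu>. time_one \<mu> x $ i - F \<mu> x $ i) holomorphic_on ball 0 \<mu>max"
      using x x\<delta> by (intro holomorphic_on_diff time_one_holomorphic curve_component_holomorphic
          curve_diff_at_F curve_diff_at_const field_differentiable_ident) auto
    show "cmod (time_one z x $ i - F z x $ i) \<le> 3 * \<mu>max" if "z \<in> ball 0 \<mu>max" for z
    proof -
      have "max_norm (time_one z x - F z x) \<le> 3 * \<mu>max"
        using max_norm_diff_triangle[of "time_one z x - x" "F z x - x"] that
          time_one_displacement[OF x, of z] F_displacement[OF x\<delta>, of z] by simp
      then show ?thesis by (simp add: max_norm_le_iff)
    qed
    show "cmod (time_one z x $ i - F z x $ i) \<le> C * cmod z ^ Suc m" if "z \<noteq> 0" "cmod z < s" for z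
    proof -
      have "cmod ((F z x - time_one z x) $ i) \<le> norm (F z x - time_one z x)"
        by (rule Finite_Cartesian_Product.norm_nth_le)
      with C[OF that] show ?thesis by (simp add: norm_minus_commute)
    qed
  qed (use s \<mu> in auto)
  then show "cmod ((time_one \<mu> x - F \<mu> x) $ i) \<le> 3 * \<mu>max * (cmod \<mu> / \<mu>max) ^ Suc m" by simp
qed

end

section \<open>Exponentially small interpolation error\<close>

lemma sup_norm_on_le_iff:
  "0 \<le> b \<Longrightarrow> sup_norm_on D g \<le> ennreal b \<longleftrightarrow> (\<forall>x\<in>D. max_norm (g x) \<le> b)"
  by (simp add: sup_norm_on_def SUP_le_iff)

theorem theorem1:
  fixes D0 :: "(complex ^ 'n) set"
    and f :: "complex ^ 'n \<Rightarrow> complex ^ 'n"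
    and \<delta> \<epsilon> M :: real
  assumes "\<delta> > 0"
    and "holomorphic_map_on f (complex_nbhd D0 \<delta>)"
    and "sup_norm_on (complex_nbhd D0 \<delta>) (\<lambda>x. f x - x) = ennreal \<epsilon>"
    and "\<epsilon> > 0"
    and "\<epsilon> / \<delta> \<le> 1 / (6 * exp 1)"
    and "M = \<delta> / (6 * exp 1 * \<epsilon>)"
  shows "(\<forall>m::nat. 2 \<le> m \<and> real m \<le> M + 1 \<longrightarrow>
      (\<forall>x \<in> complex_nbhd D0 (\<delta> / 3). \<forall>i\<le>m. iterate_defined_at f (complex_nbhd D0 \<delta>) i x) \<and>
      holomorphic_map_on (interp_field f m) (complex_nbhd D0 (\<delta> / 3)) \<and>
      sup_norm_on (complex_nbhd D0 (\<delta> / 3)) (interp_field f m) \<le> ennreal (2 * \<epsilon>) \<and>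
      (\<forall>x \<in> D0. flow_defined_at (complex_nbhd D0 (\<delta> / 3)) (interp_field f m) 1 x) \<and>
      sup_norm_on D0 (\<lambda>x. flow (complex_nbhd D0 (\<delta> / 3)) (interp_field f m) 1 x - f x)
        \<le> ennreal (3 * \<epsilon> * (6 * (real m - 1) * \<epsilon> / \<delta>) ^ m)) \<and>
    (\<forall>m::nat. int m = \<lfloor>M\<rfloor> + 1 \<longrightarrow>
      (\<forall>x \<in> D0. flow_defined_at (complex_nbhd D0 (\<delta> / 3)) (interp_field f m) 1 x) \<and>
      sup_norm_on D0 (\<lambda>x. flow (complex_nbhd D0 (\<delta> / 3)) (interp_field f m) 1 x - f x)
        \<le> ennreal (3 * \<epsilon> * exp (- (\<delta> / (6 * exp 1 * \<epsilon>)))))"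
proof -
  define g where "g = (\<lambda>x. complex_of_real (1 / \<epsilon>) *s (f x - x))"
  have disp: "max_norm (f x - x) \<le> \<epsilon>" if "x \<in> complex_nbhd D0 \<delta>" for x
    using assms(3,4) that sup_norm_on_le_iff[of \<epsilon> "complex_nbhd D0 \<delta>" "\<lambda>x. f x - x"] by simp
  interpret displacement D0 \<delta> g
  proof
    show "0 < \<delta>" by fact
    show "holomorphic_map_on g (complex_nbhd D0 \<delta>)"
      using assms(2) unfolding g_def holomorphic_map_on_iff_cdiff_at
      by (intro ballI cdiff_at_smult cdiff_at_diff cdiff_at_id) auto
    show "max_norm (g x) \<le> 1" if "x \<in> complex_nbhd D0 \<delta>" for x
      using disp[OF that] assms(4) unfolding g_def max_norm_smult by (simp add: norm_divide)
  qed
  have Ff: "F (complex_of_real \<epsilon>) = f"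
  proof
    show "F (complex_of_real \<epsilon>) x = f x" for x
      unfolding F_def using assms(4) by (simp add: g_def vector_smult_assoc)
  qed
  have main: "(\<forall>x \<in> complex_nbhd D0 (\<delta> / 3). \<forall>i\<le>m. iterate_defined_at f (complex_nbhd D0 \<delta>) i x) \<and>
      holomorphic_map_on (interp_field f m) (complex_nbhd D0 (\<delta> / 3)) \<and>
      sup_norm_on (complex_nbhd D0 (\<delta> / 3)) (interp_field f m) \<le> ennreal (2 * \<epsilon>) \<and>
      (\<forall>x \<in> D0. flow_defined_at (complex_nbhd D0 (\<delta> / 3)) (interp_field f m) 1 x) \<and>
      sup_norm_on D0 (\<lambda>x. flow (complex_nbhd D0 (\<delta> / 3)) (interp_field f m) 1 x - f x)
        \<le> ennreal (3 * \<epsilon> * (6 * (real m - 1) * \<epsilon> / \<delta>) ^ m)"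
    if m: "2 \<le> m" "real m \<le> M + 1" for m
  proof -
    interpret interpolation D0 \<delta> g m by unfold_locales fact
    \<comment> \<open>The factor \<open>exp 1\<close> in \<open>M\<close> puts \<open>\<epsilon>\<close> strictly inside the parameter disc.\<close>
    have "(real m - 1) * (6 * exp 1 * \<epsilon>) \<le> M * (6 * exp 1 * \<epsilon>)"
      using m assms(4) by (intro mult_right_mono) auto
    also have "\<dots> = \<delta>" using assms(4,6) by simp
    finally have le: "(real m - 1) * (6 * exp 1 * \<epsilon>) \<le> \<delta>" .
    have "(real m - 1) * (6 * 1 * \<epsilon>) < (real m - 1) * (6 * exp 1 * \<epsilon>)"
      using m assms(4) by (intro mult_strict_left_mono mult_strict_right_mono) auto
    then have "(real m - 1) * (6 * 1 * \<epsilon>) < \<delta>" using le by (rule less_le_trans)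
    then have lt: "cmod (of_real \<epsilon>) < \<mu>max"
      using m assms(4) by (simp add: \<mu>max_def field_simps)
    have err: "max_norm (time_one (of_real \<epsilon>) x - f x) \<le> 3 * \<epsilon> * (6 * (real m - 1) * \<epsilon> / \<delta>) ^ m"
      if "x \<in> D0" for x
    proof -
      have "max_norm (time_one (of_real \<epsilon>) x - f x) \<le> 3 * \<mu>max * (\<epsilon> / \<mu>max) ^ Suc m"
        using time_one_error[OF that lt] assms(4) by (simp add: Ff)
      also have "\<dots> = 3 * \<epsilon> * (\<epsilon> / \<mu>max) ^ m" using \<mu>max_pos by simp
      also have "\<epsilon> / \<mu>max = 6 * (real m - 1) * \<epsilon> / \<delta>" by (simp add: \<mu>max_def mult_ac)
      finally show ?thesis .
    qed
    have nn: "0 \<le> 3 * \<epsilon> * (6 * (real m - 1) * \<epsilon> / \<delta>) ^ m"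
      using m assms(1,4) by simp
    show ?thesis
    proof (intro conjI ballI allI impI)
      show "iterate_defined_at f (complex_nbhd D0 \<delta>) i x" if "x \<in> complex_nbhd D0 (\<delta> / 3)" "i \<le> m" for x i
        using iterates_defined_third[OF that(1) _ that(2), of "of_real \<epsilon>"] lt by (simp add: Ff)
      show "holomorphic_map_on (interp_field f m) (complex_nbhd D0 (\<delta> / 3))"
        using cdiff_at_X[of _ "of_real \<epsilon>"] lt by (simp add: Ff holomorphic_map_on_iff_cdiff_at)
      show "sup_norm_on (complex_nbhd D0 (\<delta> / 3)) (interp_field f m) \<le> ennreal (2 * \<epsilon>)"
        using X_bound[of _ "of_real \<epsilon>"] lt assms(4) by (simp add: Ff sup_norm_on_le_iff)
      show "flow_defined_at (complex_nbhd D0 (\<delta> / 3)) (interp_field f m) 1 x" if "x \<in> D0" for x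
        using flow_defined[OF that lt] by (simp add: Ff)
      show "sup_norm_on D0 (\<lambda>x. flow (complex_nbhd D0 (\<delta> / 3)) (interp_field f m) 1 x - f x)
          \<le> ennreal (3 * \<epsilon> * (6 * (real m - 1) * \<epsilon> / \<delta>) ^ m)"
        using err nn by (simp add: Ff sup_norm_on_le_iff)
    qed
  qed
  have optimal: "(\<forall>x \<in> D0. flow_defined_at (complex_nbhd D0 (\<delta> / 3)) (interp_field f m) 1 x) \<and>
      sup_norm_on D0 (\<lambda>x. flow (complex_nbhd D0 (\<delta> / 3)) (interp_field f m) 1 x - f x)
        \<le> ennreal (3 * \<epsilon> * exp (- (\<delta> / (6 * exp 1 * \<epsilon>))))"
    if m: "int m = \<lfloor>M\<rfloor> + 1" for m
  proof -
    have "\<epsilon> * (6 * exp 1) \<le> \<delta>" using assms(1,5) by (simp add: field_simps)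
    then have "1 \<le> M" using assms(4) unfolding assms(6) by (simp add: le_divide_eq mult_ac)
    then have m2: "2 \<le> m" using m by linarith
    have mM: "real m \<le> M + 1" "M \<le> real m" using m by linarith+
    have "6 * (real m - 1) * \<epsilon> / \<delta> \<le> 6 * M * \<epsilon> / \<delta>"
      using mM assms(1,4) by (intro divide_right_mono mult_right_mono) auto
    also have "\<dots> = exp (- 1)" using assms(1,4,6) by (simp add: exp_minus field_simps)
    finally have "(6 * (real m - 1) * \<epsilon> / \<delta>) ^ m \<le> exp (- 1) ^ m"
      using m2 assms(1,4) by (intro power_mono) auto
    also have "\<dots> = exp (- real m)" by (simp flip: exp_of_nat_mult)
    also have "\<dots> \<le> exp (- M)" using mM by simp
    finally have "3 * \<epsilon> * (6 * (real m - 1) * \<epsilon> / \<delta>) ^ m \<le> 3 * \<epsilon> * exp (- (\<delta> / (6 * exp 1 * \<epsilon>)))"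
      using assms(4,6) by simp
    then have "ennreal (3 * \<epsilon> * (6 * (real m - 1) * \<epsilon> / \<delta>) ^ m) \<le> ennreal (3 * \<epsilon> * exp (- (\<delta> / (6 * exp 1 * \<epsilon>))))"
      by (rule ennreal_leI)
    then show ?thesis using main[OF m2 mM(1)] order_trans by blast
  qed
  from main optimal show ?thesis by blast
qed

end
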